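(* There is an algorithm $\mathcal R^*$ which takes as input a nondeterministic (resp. deterministic) finite acceptor $M$ over finite words and has restricted subset query access to a language $L\subseteq\Sigma^*$ with nondeterministic (resp. deterministic) finite acceptors as inputs, and which correctly answers the unrestricted subset query with $M$ about $L$. Additionally, if $L$ is recognized by a deterministic finite acceptor $T_L$, then $\mathcal R^*(M)$ runs in time bounded by a polynomial in $|M|$ and $|T_L|$ (the cardinality of $\Sigma$ being treated as a constant).
   Context: $\Sigma$ is a finite alphabet; $|M|$ denotes the number of states of an acceptor. A restricted subset query about $L$ with an acceptor $N$ is answered "yes" if $L(N)\subseteq L$ and "no" otherwise (with no counterexample). An unrestricted subset query about $L$ with $M$ is answered "yes" if $L(M)\subseteq L$, and otherwise "no" together with a counterexample word $u\in L(M)\setminus L$. *)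

theory Defs
  imports Main
begin

section \<open>Finite acceptors\<close>

text \<open>The alphabet is a finite type, so it is fixed once and for all and contributes only
  constants.\<close>

record ('q, 'a) acceptor =
  states :: "'q set"
  init :: "'q set"
  final :: "'q set"
  trans :: "('q \<times> 'a \<times> 'q) set"

definition nfa :: "('q, 'a) acceptor \<Rightarrow> bool" where
  "nfa M \<longleftrightarrow> finite (states M) \<and> init M \<subseteq> states M \<and> final M \<subseteq> states M
     \<and> trans M \<subseteq> states M \<times> UNIV \<times> states M"

definition dfa :: "('q, 'a) acceptor \<Rightarrow> bool" where
  "dfa M \<longleftrightarrow> nfa M \<and> (\<exists>!q. q \<in> init M)
     \<and> (\<forall>q\<in>states M. \<forall>a. \<exists>!q'. (q, a, q') \<in> trans M)"

primrec path :: "('q, 'a) acceptor \<Rightarrow> 'q \<Rightarrow> 'a list \<Rightarrow> 'q \<Rightarrow> bool" where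
  "path M p [] q \<longleftrightarrow> p = q"
| "path M p (a # w) q \<longleftrightarrow> (\<exists>r. (p, a, r) \<in> trans M \<and> path M r w q)"

definition lang :: "('q, 'a) acceptor \<Rightarrow> 'a list set" where
  "lang M = {w. \<exists>p\<in>init M. \<exists>q\<in>final M. path M p w q}"

section \<open>Data and its encodings\<close>

text \<open>Algorithms compute on finite binary trees whose leaves are letters or \<open>Leaf\<close>.
  \<open>Leaf\<close> also stands for the empty list and for false.\<close>

datatype 'a data = Leaf | Sym 'a | Node "'a data" "'a data"

primrec dsize :: "'a data \<Rightarrow> nat" where
  "dsize Leaf = 1"
| "dsize (Sym a) = 1"
| "dsize (Node x y) = 1 + dsize x + dsize y"

fun left :: "'a data \<Rightarrow> 'a data" where
  "left (Node x y) = x"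
| "left _ = Leaf"

fun right :: "'a data \<Rightarrow> 'a data" where
  "right (Node x y) = y"
| "right _ = Leaf"

definition of_boolean :: "bool \<Rightarrow> 'a data" where
  "of_boolean b = (if b then Node Leaf Leaf else Leaf)"

primrec of_list :: "'a data list \<Rightarrow> 'a data" where
  "of_list [] = Leaf"
| "of_list (x # xs) = Node x (of_list xs)"

text \<open>Numbers are in unary; an encoded acceptor contains no number larger than its number
  of states, so its size is polynomial in that number.\<close>

definition of_number :: "nat \<Rightarrow> 'a data" where
  "of_number n = of_list (replicate n Leaf)"

definition of_word :: "'a list \<Rightarrow> 'a data" where
  "of_word w = of_list (map Sym w)"

definition of_transition :: "nat \<times> 'a \<times> nat \<Rightarrow> 'a data" where
  "of_transition = (\<lambda>(p, a, q). Node (of_number p) (Node (Sym a) (of_number q)))"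

text \<open>\<open>describes d M\<close>: after numbering its states by \<open>0, \<dots>, |M| - 1\<close>, the acceptor \<open>M\<close> is given
  by \<open>d\<close> as its number of states and repetition-free lists (in any order) of its initial
  states, final states and transitions.\<close>

definition describes :: "'a data \<Rightarrow> ('q, 'a) acceptor \<Rightarrow> bool" where
  "describes d M \<longleftrightarrow> (\<exists>\<nu> is fs ts.
     bij_betw \<nu> (states M) {..<card (states M)}
     \<and> distinct is \<and> set is = \<nu> ` init M
     \<and> distinct fs \<and> set fs = \<nu> ` final M
     \<and> distinct ts \<and> set ts = (\<lambda>(p, a, q). (\<nu> p, a, \<nu> q)) ` trans M
     \<and> d = of_list [of_number (card (states M)), of_list (map of_number is),
                    of_list (map of_number fs), of_list (map of_transition ts)])"

section \<open>Oracle algorithms and their running time\<close>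

text \<open>An algorithm is a program of a first-order, call-by-value functional language with
  recursion. \<open>Var i\<close> is the \<open>i\<close>-th argument of the function being evaluated, \<open>Call f es\<close> calls the
  \<open>f\<close>-th function of the program, and \<open>Query e\<close> puts the value of \<open>e\<close> to the oracle. The test of
  \<open>Cond\<close> fails exactly on \<open>Leaf\<close>.\<close>

datatype 'a expr =
    Var nat
  | MkLeaf
  | MkSym 'a
  | MkNode "'a expr" "'a expr"
  | Left "'a expr"
  | Right "'a expr"
  | Equal "'a expr" "'a expr"
  | Cond "'a expr" "'a expr" "'a expr"
  | Call nat "'a expr list"
  | Query "'a expr"

type_synonym 'a program = "'a expr list"

text \<open>\<open>eval P orc env e v t\<close>: with arguments \<open>env\<close>, the expression \<open>e\<close> evaluates to \<open>v\<close> in time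
  \<open>t\<close>. Here \<open>orc d b\<close> says that \<open>b\<close> is the oracle's answer to the query \<open>d\<close>; evaluation is stuck on
  a query that has no answer. Every step costs one unit, and in addition building a pair costs
  the size of the whole new tree, comparing costs the sizes of both trees, and a query costs
  the size of the queried tree. Hence no value that occurs in a computation is larger than the
  input size plus the time (up to a constant), so that this time agrees with that of oracle
  Turing machines up to a polynomial, without assuming that subtrees are shared.\<close>

inductive eval :: "'a program \<Rightarrow> ('a data \<Rightarrow> bool \<Rightarrow> bool) \<Rightarrow> 'a data list \<Rightarrow> 'a expr
    \<Rightarrow> 'a data \<Rightarrow> nat \<Rightarrow> bool"
  and evals :: "'a program \<Rightarrow> ('a data \<Rightarrow> bool \<Rightarrow> bool) \<Rightarrow> 'a data list \<Rightarrow> 'a expr list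
    \<Rightarrow> 'a data list \<Rightarrow> nat \<Rightarrow> bool"
  for P :: "'a program" and orc :: "'a data \<Rightarrow> bool \<Rightarrow> bool" where
  eval_Var: "i < length env \<Longrightarrow> eval P orc env (Var i) (env ! i) 1"
| eval_MkLeaf: "eval P orc env MkLeaf Leaf 1"
| eval_MkSym: "eval P orc env (MkSym a) (Sym a) 1"
| eval_MkNode: "\<lbrakk>eval P orc env e1 v1 t1; eval P orc env e2 v2 t2\<rbrakk>
    \<Longrightarrow> eval P orc env (MkNode e1 e2) (Node v1 v2) (t1 + t2 + 1 + dsize (Node v1 v2))"
| eval_Left: "eval P orc env e v t \<Longrightarrow> eval P orc env (Left e) (left v) (t + 1)"
| eval_Right: "eval P orc env e v t \<Longrightarrow> eval P orc env (Right e) (right v) (t + 1)"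
| eval_Equal: "\<lbrakk>eval P orc env e1 v1 t1; eval P orc env e2 v2 t2\<rbrakk>
    \<Longrightarrow> eval P orc env (Equal e1 e2) (of_boolean (v1 = v2)) (t1 + t2 + 1 + dsize v1 + dsize v2)"
| eval_Cond_true: "\<lbrakk>eval P orc env e v t; v \<noteq> Leaf; eval P orc env e1 v1 t1\<rbrakk>
    \<Longrightarrow> eval P orc env (Cond e e1 e2) v1 (t + t1 + 1)"
| eval_Cond_false: "\<lbrakk>eval P orc env e Leaf t; eval P orc env e2 v2 t2\<rbrakk>
    \<Longrightarrow> eval P orc env (Cond e e1 e2) v2 (t + t2 + 1)"
| eval_Call: "\<lbrakk>evals P orc env es vs t; f < length P; eval P orc vs (P ! f) v t'\<rbrakk>
    \<Longrightarrow> eval P orc env (Call f es) v (t + t' + 1)"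
| eval_Query: "\<lbrakk>eval P orc env e d t; orc d b\<rbrakk>
    \<Longrightarrow> eval P orc env (Query e) (of_boolean b) (t + 1 + dsize d)"
| evals_Nil: "evals P orc env [] [] 0"
| evals_Cons: "\<lbrakk>eval P orc env e v t; evals P orc env es vs t'\<rbrakk>
    \<Longrightarrow> evals P orc env (e # es) (v # vs) (t + t')"

inductive_cases eval_elims:
  "eval P orc env (Var i) v t"
  "eval P orc env MkLeaf v t"
  "eval P orc env (MkSym a) v t"
  "eval P orc env (MkNode e1 e2) v t"
  "eval P orc env (Left e) v t"
  "eval P orc env (Right e) v t"
  "eval P orc env (Equal e1 e2) v t"
  "eval P orc env (Cond e e1 e2) v t"
  "eval P orc env (Call f es) v t"
  "eval P orc env (Query e) v t"
  "evals P orc env [] vs t"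
  "evals P orc env (e # es) vs t"

text \<open>For an oracle with unique answers, result and running time are unique, so it is enough to
  assert the existence of a run.\<close>

lemma eval_deterministic:
  assumes orc: "\<And>d b b'. orc d b \<Longrightarrow> orc d b' \<Longrightarrow> b = b'"
  shows "eval P orc env e v t \<Longrightarrow> eval P orc env e v' t' \<Longrightarrow> v = v' \<and> t = t'"
    and "evals P orc env es vs s \<Longrightarrow> evals P orc env es vs' s' \<Longrightarrow> vs = vs' \<and> s = s'"
proof (induction arbitrary: v' t' and vs' s' rule: eval_evals.inducts)
  case (eval_Query env e d t b)
  from eval_Query.prems show ?case
    by (rule eval_elims) (auto dest: eval_Query(2) orc[OF eval_Query(3)])
next
  case eval_MkNode
  from eval_MkNode.prems show ?case
    by (rule eval_elims) (auto dest: eval_MkNode(2,4))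
next
  case eval_Equal
  from eval_Equal.prems show ?case
    by (rule eval_elims) (auto dest: eval_Equal(2,4))
next
  case eval_Cond_true
  from eval_Cond_true.prems show ?case
    by (rule eval_elims) (use eval_Cond_true(5) in \<open>auto dest: eval_Cond_true(2,4)\<close>)
next
  case eval_Cond_false
  from eval_Cond_false.prems show ?case
    by (rule eval_elims) (auto dest: eval_Cond_false(2,4))+
next
  case eval_Call
  from eval_Call.prems show ?case
    by (rule eval_elims) (auto dest: eval_Call(2,5))
next
  case evals_Cons
  from evals_Cons.prems show ?case
    by (rule eval_elims) (auto dest: evals_Cons(2,4))
next
  case eval_Left
  from eval_Left.prems show ?case
    by (rule eval_elims) (auto dest: eval_Left(2))
next
  case eval_Right
  from eval_Right.prems show ?case
    by (rule eval_elims) (auto dest: eval_Right(2))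
next
  case eval_Var
  from eval_Var.prems show ?case by (rule eval_elims) auto
next
  case eval_MkLeaf
  from eval_MkLeaf.prems show ?case by (rule eval_elims) auto
next
  case eval_MkSym
  from eval_MkSym.prems show ?case by (rule eval_elims) auto
next
  case evals_Nil
  from evals_Nil.prems show ?case by (rule eval_elims) auto
qed

text \<open>A run starts by applying the first function of the program to the input.\<close>

definition runs :: "'a program \<Rightarrow> ('a data \<Rightarrow> bool \<Rightarrow> bool) \<Rightarrow> 'a data \<Rightarrow> 'a data \<Rightarrow> nat \<Rightarrow> bool"
  where "runs P orc d v t \<longleftrightarrow> P \<noteq> [] \<and> eval P orc [d] (P ! 0) v t"

section \<open>Subset queries\<close>

text \<open>\<open>C\<close> is the class of acceptors with which queries may be made. Every finite acceptor is
  isomorphic to one with natural numbers as states.\<close>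

definition restricted_subset_query ::
    "((nat, 'a) acceptor \<Rightarrow> bool) \<Rightarrow> 'a list set \<Rightarrow> 'a data \<Rightarrow> bool \<Rightarrow> bool" where
  "restricted_subset_query C L d b \<longleftrightarrow>
     (\<exists>N. C N \<and> describes d N \<and> (b \<longleftrightarrow> lang N \<subseteq> L))"

lemma path_rename:
  assumes "nfa M" "inj_on \<nu> (states M)"
    and "trans M' = (\<lambda>(p, a, q). (\<nu> p, a, \<nu> q)) ` trans M"
  shows "p \<in> states M \<Longrightarrow> path M' (\<nu> p) w q' \<longleftrightarrow> (\<exists>q\<in>states M. q' = \<nu> q \<and> path M p w q)"
proof (induction w arbitrary: p)
  case Nil
  then show ?case by auto
next
  case (Cons a w)
  have tr: "(\<nu> p, a, r') \<in> trans M' \<longleftrightarrow> (\<exists>r\<in>states M. r' = \<nu> r \<and> (p, a, r) \<in> trans M)" for r'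
  proof
    assume "(\<nu> p, a, r') \<in> trans M'"
    then obtain p0 r where *: "(p0, a, r) \<in> trans M" "\<nu> p = \<nu> p0" "r' = \<nu> r"
      using assms(3) by auto
    then have "p0 \<in> states M" "r \<in> states M"
      using assms(1) by (auto simp: nfa_def)
    with * Cons.prems have "p0 = p" using assms(2) by (metis inj_onD)
    with * \<open>r \<in> states M\<close> show "\<exists>r\<in>states M. r' = \<nu> r \<and> (p, a, r) \<in> trans M" by blast
  next
    assume "\<exists>r\<in>states M. r' = \<nu> r \<and> (p, a, r) \<in> trans M"
    then show "(\<nu> p, a, r') \<in> trans M'" using assms(3) by force
  qed
  have "path M' (\<nu> p) (a # w) q' \<longleftrightarrow>
      (\<exists>r\<in>states M. (p, a, r) \<in> trans M \<and> path M' (\<nu> r) w q')"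
    using tr by auto
  also have "\<dots> \<longleftrightarrow>
      (\<exists>r\<in>states M. (p, a, r) \<in> trans M \<and> (\<exists>q\<in>states M. q' = \<nu> q \<and> path M r w q))"
    using Cons.IH by auto
  also have "\<dots> \<longleftrightarrow> (\<exists>q\<in>states M. q' = \<nu> q \<and> path M p (a # w) q)"
    using assms(1) by (auto simp: nfa_def)
  finally show ?case .
qed

lemma lang_rename:
  assumes "nfa M" "inj_on \<nu> (states M)"
    and "init M' = \<nu> ` init M" "final M' = \<nu> ` final M"
    and "trans M' = (\<lambda>(p, a, q). (\<nu> p, a, \<nu> q)) ` trans M"
  shows "lang M' = lang M"
proof -
  have sub: "init M \<subseteq> states M" "final M \<subseteq> states M" using assms(1) by (auto simp: nfa_def)
  have "path M' (\<nu> p) w (\<nu> q) \<longleftrightarrow> path M p w q" if "p \<in> states M" "q \<in> states M" for p q w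
    using path_rename[OF assms(1,2,5) that(1)] that(2) assms(2) by (metis inj_onD)
  then show ?thesis
    unfolding lang_def assms(3,4) using sub by (auto simp: subset_iff)
qed

lemma of_list_inject: "of_list xs = of_list ys \<longleftrightarrow> xs = ys"
proof (induction xs arbitrary: ys)
  case Nil
  then show ?case by (cases ys) auto
next
  case (Cons x xs)
  then show ?case by (cases ys) auto
qed

lemma inj_of_number: "inj of_number"
  by (auto intro!: injI simp: of_number_def of_list_inject dest: arg_cong[where f = length])

lemma inj_of_transition: "inj of_transition"
  by (auto intro!: injI simp: of_transition_def inj_eq[OF inj_of_number])

lemma describes_lang_unique:
  fixes M :: "('q, 'a) acceptor" and N :: "('r, 'a) acceptor"
  assumes "describes d M" "describes d N" "nfa M" "nfa N"
  shows "lang M = lang N"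
proof -
  obtain \<nu> "is" fs ts where M: "bij_betw \<nu> (states M) {..<card (states M)}"
    "set is = \<nu> ` init M" "set fs = \<nu> ` final M"
    "set ts = (\<lambda>(p, a, q). (\<nu> p, a, \<nu> q)) ` trans M"
    "d = of_list [of_number (card (states M)), of_list (map of_number is),
                  of_list (map of_number fs), of_list (map of_transition ts)]"
    using assms(1) unfolding describes_def by blast
  obtain \<mu> js gs us where N: "bij_betw \<mu> (states N) {..<card (states N)}"
    "set js = \<mu> ` init N" "set gs = \<mu> ` final N"
    "set us = (\<lambda>(p, a, q). (\<mu> p, a, \<mu> q)) ` trans N"
    "d = of_list [of_number (card (states N)), of_list (map of_number js),
                  of_list (map of_number gs), of_list (map of_transition us)]"
    using assms(2) unfolding describes_def by blast
  have eqs: "is = js" "fs = gs" "ts = us"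
    using M(5) N(5) by (simp_all add: of_list_inject inj_map_eq_map inj_of_number inj_of_transition)
  define A :: "(nat, 'a) acceptor" where
    "A = \<lparr>states = {..<card (states M)}, init = set is, final = set fs, trans = set ts\<rparr>"
  have "lang A = lang M"
    by (rule lang_rename[where \<nu> = \<nu>]) (use assms(3) M in \<open>auto simp: A_def bij_betw_def\<close>)
  moreover have "lang A = lang N"
    by (rule lang_rename[where \<nu> = \<mu>]) (use assms(4) N eqs in \<open>auto simp: A_def bij_betw_def\<close>)
  ultimately show ?thesis by simp
qed

lemma restricted_subset_query_unique:
  assumes "\<And>N. C N \<Longrightarrow> nfa N" "restricted_subset_query C L d b" "restricted_subset_query C L d b'"
  shows "b = b'"
  using assms describes_lang_unique unfolding restricted_subset_query_def by metis

definition yes_answer :: "'a data" where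
  "yes_answer = Node (of_boolean True) Leaf"

definition no_answer :: "'a list \<Rightarrow> 'a data" where
  "no_answer u = Node (of_boolean False) (of_word u)"

definition correct_unrestricted_answer ::
    "('q, 'a) acceptor \<Rightarrow> 'a list set \<Rightarrow> 'a data \<Rightarrow> bool" where
  "correct_unrestricted_answer M L v \<longleftrightarrow>
     (if lang M \<subseteq> L then v = yes_answer else (\<exists>u \<in> lang M - L. v = no_answer u))"

section \<open>Polynomials in two variables\<close>

definition bivariate_polynomial :: "(nat \<Rightarrow> nat \<Rightarrow> nat) \<Rightarrow> bool" where
  "bivariate_polynomial p \<longleftrightarrow>
     (\<exists>D c. \<forall>x y. p x y = (\<Sum>i\<le>D. \<Sum>j\<le>D. c i j * x ^ i * y ^ j))"

end

theory Submission
  imports Defs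
begin

text \<open>For a pattern of \<open>\<ell>\<close> letters and wildcards, the words of \<open>M\<close> that match the pattern are
  recognized by a product of \<open>M\<close> with a chain of \<open>\<ell> + 2\<close> states, which is deterministic and complete whenever
  \<open>M\<close> is. Querying the patterns of \<open>0, 1, 2, \<dots>\<close> wildcards finds the length \<open>m\<close> of a shortest
  counterexample, and then its letters are determined one by one, from the last to the first, by
  querying \<open>k\<close> wildcards followed by a candidate letter and the letters already known. By the
  pigeonhole principle on the runs of \<open>M\<close> and \<open>T\<^sub>L\<close>, \<open>m < |M| |T\<^sub>L|\<close>; since the procedure itself is
  polynomial in \<open>|M|\<close> and \<open>m\<close>, it never needs to know \<open>T\<^sub>L\<close> and stops even when \<open>L\<close> is not
  regular.\<close>

section \<open>Evaluation within a time bound\<close>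

text \<open>Queries may only be put with acceptors of the class of \<open>M\<close>, so a pattern
  has to be imposed on \<open>M\<close> without losing determinism or completeness: a failed match
  cannot simply drop its transition. The yes/no answers suffice because no choice is ever revised:
  if a known suffix extends to a counterexample with k + 1 more letters, then some letter put in
  front of it gives a suffix that extends with k more. Fixing the letters from the end lets the
  program extend the suffix by building a single pair. Patterns have at most m letters, so every
  queried acceptor has at most |M|(m + 2) states, and one number that bounds all encodings controls
  every subroutine. The language enters the time only through m.\<close>

definition eval_le where
  "eval_le P orc env e v b \<longleftrightarrow> (\<exists>t\<le>b. eval P orc env e v t)"

definition evals_le where
  "evals_le P orc env es vs b \<longleftrightarrow> (\<exists>t\<le>b. evals P orc env es vs t)"

text \<open>Applied first, it leaves value and bound schematic: the evaluation rules then compute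
  both, and what remains is an equation and an arithmetic inequality.\<close>

lemma eval_le_weaken: "eval_le P orc env e v b \<Longrightarrow> v = v' \<Longrightarrow> b \<le> b' \<Longrightarrow> eval_le P orc env e v' b'"
  unfolding eval_le_def using order_trans by blast

lemma eval_le_Var: "i < length env \<Longrightarrow> env ! i = v \<Longrightarrow> eval_le P orc env (Var i) v 1"
  unfolding eval_le_def using eval_Var by fastforce

lemma eval_le_MkLeaf: "eval_le P orc env MkLeaf Leaf 1"
  unfolding eval_le_def using eval_MkLeaf by fastforce

lemma eval_le_MkSym: "eval_le P orc env (MkSym a) (Sym a) 1"
  unfolding eval_le_def using eval_MkSym by fastforce

lemma eval_le_MkNode:
  "\<lbrakk>eval_le P orc env e1 v1 b1; eval_le P orc env e2 v2 b2\<rbrakk>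
    \<Longrightarrow> eval_le P orc env (MkNode e1 e2) (Node v1 v2) (b1 + b2 + 1 + dsize (Node v1 v2))"
  unfolding eval_le_def by (meson add_le_mono eval_MkNode le_refl)

lemma eval_le_Left:
  "eval_le P orc env e v b \<Longrightarrow> left v = v' \<Longrightarrow> eval_le P orc env (Left e) v' (b + 1)"
  unfolding eval_le_def by (meson add_le_mono eval_Left le_refl)

lemma eval_le_Right:
  "eval_le P orc env e v b \<Longrightarrow> right v = v' \<Longrightarrow> eval_le P orc env (Right e) v' (b + 1)"
  unfolding eval_le_def by (meson add_le_mono eval_Right le_refl)

lemma eval_le_Equal:
  "\<lbrakk>eval_le P orc env e1 v1 b1; eval_le P orc env e2 v2 b2; of_boolean (v1 = v2) = v\<rbrakk>
    \<Longrightarrow> eval_le P orc env (Equal e1 e2) v (b1 + b2 + 1 + dsize v1 + dsize v2)"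
  unfolding eval_le_def by (metis add_le_mono eval_Equal le_refl)

lemma eval_le_Cond_true:
  "\<lbrakk>eval_le P orc env e v b; v \<noteq> Leaf; eval_le P orc env e1 v1 b1\<rbrakk>
    \<Longrightarrow> eval_le P orc env (Cond e e1 e2) v1 (b + b1 + 1)"
  unfolding eval_le_def by (meson add_le_mono eval_Cond_true le_refl)

lemma eval_le_Cond_false:
  "\<lbrakk>eval_le P orc env e v b; v = Leaf; eval_le P orc env e2 v2 b2\<rbrakk>
    \<Longrightarrow> eval_le P orc env (Cond e e1 e2) v2 (b + b2 + 1)"
  unfolding eval_le_def by (metis add_le_mono eval_Cond_false le_refl)

text \<open>The body comes first, so that a known fact about it determines the argument values.\<close>

lemma eval_le_Call:
  "\<lbrakk>eval_le P orc vs (P ! f) v b'; f < length P; evals_le P orc env es vs b\<rbrakk>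
    \<Longrightarrow> eval_le P orc env (Call f es) v (b + b' + 1)"
  unfolding eval_le_def evals_le_def by (meson add_le_mono eval_Call le_refl)

lemma eval_le_Query:
  "\<lbrakk>eval_le P orc env e d b; orc d r; of_boolean r = v\<rbrakk>
    \<Longrightarrow> eval_le P orc env (Query e) v (b + 1 + dsize d)"
  unfolding eval_le_def by (metis add_le_mono eval_Query le_refl)

lemma evals_le_Nil: "evals_le P orc env [] [] 0"
  unfolding evals_le_def using evals_Nil by blast

lemma evals_le_Cons:
  "\<lbrakk>eval_le P orc env e v b; evals_le P orc env es vs b'\<rbrakk>
    \<Longrightarrow> evals_le P orc env (e # es) (v # vs) (b + b')"
  unfolding eval_le_def evals_le_def by (meson add_le_mono evals_Cons)

lemmas eval_le_rules = eval_le_Var eval_le_MkLeaf eval_le_MkSym eval_le_MkNode eval_le_Left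
  eval_le_Right eval_le_Equal evals_le_Nil evals_le_Cons

section \<open>The program and its running time\<close>

text \<open>The functions are numbered as in \<open>prog\<close> below. Appending adds unary numbers. The
  arguments are: for \<open>shift_body\<close> a summand and a list of numbers; for \<open>layer_body\<close> the offsets
  of the new and of the next layer, the letter or wildcard, the transitions of \<open>M\<close> and an
  accumulator; for \<open>transitions_body\<close> the number of states, the transitions and the pattern; for
  \<open>offset_body\<close> the number of states and the pattern; for \<open>build_body\<close> the input and the pattern;
  for \<open>length_body\<close> the input and some wildcards; for \<open>complete_body\<close> also the known suffix; for
  \<open>try_body\<close> also the candidate letters.\<close>

definition append_body :: "'a expr" where
  "append_body = Cond (Var 0) (MkNode (Left (Var 0)) (Call 9 [Right (Var 0), Var 1])) (Var 1)"

definition shift_body :: "'a expr" where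
  "shift_body = Cond (Var 1)
     (MkNode (Call 9 [Var 0, Left (Var 1)]) (Call 8 [Var 0, Right (Var 1)])) MkLeaf"

text \<open>The result of \<open>MkLeaf\<close> is the number 0, the offset of the sink layer. It is
  chosen exactly when \<open>Var 2\<close> is a letter other than that of the first transition; a
  wildcard is \<open>Leaf\<close> and fails the outer test.\<close>

definition target_expr :: "'a expr" where
  "target_expr = Cond (Var 2)
     (Cond (Equal (Var 2) (Left (Right (Left (Var 3))))) (Var 1) MkLeaf) (Var 1)"

definition layer_body :: "'a expr" where
  "layer_body = Cond (Var 3)
     (MkNode
        (MkNode (Call 9 [Var 0, Left (Left (Var 3))])
           (MkNode (Left (Right (Left (Var 3))))
              (Call 9 [target_expr, Right (Right (Left (Var 3)))])))
        (Call 7 [Var 0, Var 1, Var 2, Right (Var 3), Var 4]))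
     (Var 4)"

text \<open>For the empty pattern the accumulator is the transition list of \<open>M\<close> itself,
  which forms the sink layer; the accepting layer above it leads to offset 0, so that reading past
  the end of the pattern is rejected.\<close>

definition transitions_body :: "'a expr" where
  "transitions_body = Cond (Var 2)
     (Call 7 [Call 5 [Var 0, Var 2], Call 5 [Var 0, Right (Var 2)], Left (Var 2), Var 1,
              Call 6 [Var 0, Var 1, Right (Var 2)]])
     (Call 7 [Var 0, MkLeaf, MkLeaf, Var 1, Var 1])"

definition offset_body :: "'a expr" where
  "offset_body = Cond (Var 1) (Call 9 [Var 0, Call 5 [Var 0, Right (Var 1)]]) (Var 0)"

definition build_body :: "'a expr" where
  "build_body =
     MkNode (Call 9 [Left (Var 0), Call 5 [Left (Var 0), Var 1]])
       (MkNode (Call 8 [Call 5 [Left (Var 0), Var 1], Left (Right (Var 0))])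
         (MkNode (Call 8 [Left (Var 0), Left (Right (Right (Var 0)))])
           (MkNode (Call 6 [Left (Var 0), Left (Right (Right (Right (Var 0)))), Var 1]) MkLeaf)))"

text \<open>A positive answer excludes the candidate letter. There is no case for an exhausted list,
  since the search only enters this function when some candidate succeeds.\<close>

definition try_body :: "'a expr" where
  "try_body = Cond (Query (Call 4 [Var 0, Call 9 [Var 1, MkNode (Left (Var 3)) (Var 2)]]))
     (Call 3 [Var 0, Var 1, Var 2, Right (Var 3)])
     (Call 2 [Var 0, Var 1, MkNode (Left (Var 3)) (Var 2)])"

definition letters_expr :: "'a list \<Rightarrow> 'a expr" where
  "letters_expr as = foldr (\<lambda>a. MkNode (MkSym a)) as MkLeaf"

definition complete_body :: "'a list \<Rightarrow> 'a expr" where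
  "complete_body as = Cond (Var 1) (Call 3 [Var 0, Right (Var 1), Var 2, letters_expr as])
     (MkNode MkLeaf (Var 2))"

definition length_body :: "'a expr" where
  "length_body = Cond (Query (Call 4 [Var 0, Var 1])) (Call 1 [Var 0, MkNode MkLeaf (Var 1)])
     (Call 2 [Var 0, Var 1, MkLeaf])"

text \<open>The loop over lengths stops only on success, so it is entered only after the query with
  the input itself has shown that a counterexample exists.\<close>

definition main_body :: "'a expr" where
  "main_body = Cond (Query (Var 0)) (MkNode (MkNode MkLeaf MkLeaf) MkLeaf) (Call 1 [Var 0, MkLeaf])"

definition prog :: "'a list \<Rightarrow> 'a program" where
  "prog as = [main_body, length_body, complete_body as, try_body, build_body, offset_body,
     transitions_body, layer_body, shift_body, append_body]"

section \<open>Correctness and cost of the functions that build queries\<close>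

lemma length_prog: "length (prog as) = 10"
  by (simp add: prog_def)

lemma prog_nth:
  "prog as ! 0 = main_body" "prog as ! 1 = length_body" "prog as ! 2 = complete_body as"
  "prog as ! 3 = try_body" "prog as ! 4 = build_body" "prog as ! 5 = offset_body"
  "prog as ! 6 = transitions_body" "prog as ! 7 = layer_body" "prog as ! 8 = shift_body"
  "prog as ! 9 = append_body"
  by (simp_all add: prog_def)

lemma eval_le_Call_prog:
  "\<lbrakk>eval_le (prog as) orc vs body v b'; prog as ! f = body; f < 10; evals_le (prog as) orc env es
    vs b\<rbrakk>
    \<Longrightarrow> eval_le (prog as) orc env (Call f es) v (b + b' + 1)"
  using eval_le_Call length_prog by metis

text \<open>In all running times, \<open>S\<close> bounds the size of the result; since no value computed on the
  way is larger, each function costs at most \<open>S + 1\<close> calls of a body of known cost.\<close>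

definition append_time :: "nat \<Rightarrow> nat" where
  "append_time S = (S + 1) * (S + 15)"

lemma length_le_dsize: "length xs \<le> dsize (of_list xs)"
  by (induction xs) auto

lemma append_correct:
  assumes "dsize (of_list (xs @ ys)) \<le> S"
  shows "eval_le (prog as) orc [of_list xs, of_list ys] append_body (of_list (xs @ ys))
    (append_time S)"
proof -
  \<comment> \<open>The induction needs a bound that shrinks with the list; the length is replaced
    by \<open>S\<close> only afterwards.\<close>
  have "eval_le (prog as) orc [of_list xs, of_list ys] append_body (of_list (xs @ ys))
      (length xs * (S + 15) + 5)"
    using assms
  proof (induction xs)
    case Nil
    show ?case unfolding append_body_def
      by (rule eval_le_weaken, (rule eval_le_rules eval_le_Cond_false | simp)+)
  next
    case (Cons x xs)
    then have IH: "eval_le (prog as) orc [of_list xs, of_list ys] append_body (of_list (xs @ ys))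
      (length xs * (S + 15) + 5)" by simp
    show ?case
      apply (subst append_body_def)
      apply (rule eval_le_weaken)
        apply (rule eval_le_rules eval_le_Cond_true eval_le_Call_prog[OF IH prog_nth(10)] | simp)+
      using Cons.prems by simp
  qed
  moreover have "length xs * (S + 15) + 5 \<le> append_time S"
  proof -
    have "length xs \<le> S" using assms length_le_dsize[of "xs @ ys"] by simp
    then have "length xs * (S + 15) \<le> S * (S + 15)" by (rule mult_le_mono1)
    then show ?thesis unfolding append_time_def by (simp add: algebra_simps)
  qed
  ultimately show ?thesis by (rule eval_le_weaken[OF _ refl])
qed

lemma append_number_correct:
  assumes "dsize (of_number (k + m) :: 'a data) \<le> S"
  shows "eval_le (prog as) orc [of_number k, of_number m :: 'a data] append_body (of_number (k + m))
    (append_time S)"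
  using append_correct[of "replicate k Leaf" "replicate m Leaf"] assms
  by (simp add: of_number_def replicate_add)

definition offset_time :: "nat \<Rightarrow> nat" where
  "offset_time S = (S + 1) * (append_time S + 15)"

lemma dsize_of_number: "dsize (of_number n) = 2 * n + 1"
  unfolding of_number_def by (induction n) auto

text \<open>For \<open>n = 0\<close> the result is the number 0 however long the list is, so its
  size does not bound the number of calls; hence the separate bound on the length.\<close>

lemma offset_correct:
  fixes xs :: "'a data list"
  assumes "dsize (of_number (n * (length xs + 1)) :: 'a data) \<le> S" "length xs \<le> S"
  shows "eval_le (prog as) orc [of_number n, of_list xs] offset_body
    (of_number (n * (length xs + 1))) (offset_time S)"
proof -
  have "eval_le (prog as) orc [of_number n, of_list xs] offset_body
    (of_number (n * (length xs + 1))) ((length xs + 1) * (append_time S + 15))"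
    using assms(1)
  proof (induction xs)
    case Nil
    show ?case unfolding offset_body_def
      by (rule eval_le_weaken, (rule eval_le_rules eval_le_Cond_false | simp)+)
  next
    case (Cons x xs)
    then have IH: "eval_le (prog as) orc [of_number n, of_list xs] offset_body
       (of_number (n * (length xs + 1))) ((length xs + 1) * (append_time S + 15))"
      by (simp add: dsize_of_number)
    have app: "eval_le (prog as) orc [of_number n, of_number (n * (length xs + 1))] append_body
       (of_number (n + n * (length xs + 1))) (append_time S)"
      by (rule append_number_correct) (use Cons.prems in simp)
    show ?case
      apply (subst offset_body_def)
      apply (rule eval_le_weaken)
        apply (rule eval_le_rules eval_le_Cond_true eval_le_Call_prog[OF IH prog_nth(6)]
          eval_le_Call_prog[OF app prog_nth(10)] | simp)+
      done
  qed
  moreover have "(length xs + 1) * (append_time S + 15) \<le> offset_time S"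
    unfolding offset_time_def by (rule mult_le_mono1) (use assms in simp)
  ultimately show ?thesis by (rule eval_le_weaken[OF _ refl])
qed

definition shift_time :: "nat \<Rightarrow> nat" where
  "shift_time S = (S + 1) * (append_time S + S + 15)"

lemma shift_correct:
  assumes "dsize (of_list (map of_number (map ((+) k) xs)) :: 'a data) \<le> S"
  shows "eval_le (prog as) orc [of_number k, of_list (map of_number xs) :: 'a data] shift_body
    (of_list (map of_number (map ((+) k) xs))) (shift_time S)"
proof -
  have "eval_le (prog as) orc [of_number k, of_list (map of_number xs) :: 'a data] shift_body
    (of_list (map of_number (map ((+) k) xs))) ((length xs + 1) * (append_time S + S + 15))"
    using assms
  proof (induction xs)
    case Nil
    show ?case unfolding shift_body_def
      by (rule eval_le_weaken, (rule eval_le_rules eval_le_Cond_false | simp)+)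
  next
    case (Cons x xs)
    then have IH: "eval_le (prog as) orc [of_number k, of_list (map of_number xs) :: 'a data]
       shift_body (of_list (map of_number (map ((+) k) xs))) ((length xs + 1) * (append_time S +
         S + 15))"
      by simp
    have app: "eval_le (prog as) orc [of_number k, of_number x] append_body
       (of_number (k + x)) (append_time S)"
      by (rule append_number_correct) (use Cons.prems in simp)
    show ?case
      apply (subst shift_body_def)
      apply (rule eval_le_weaken)
        apply (rule eval_le_rules eval_le_Cond_true eval_le_Call_prog[OF IH prog_nth(9)]
          eval_le_Call_prog[OF app prog_nth(10)] | simp)+
      using Cons.prems by simp
  qed
  moreover have "(length xs + 1) * (append_time S + S + 15) \<le> shift_time S"
    unfolding shift_time_def
    by (rule mult_le_mono1)
      (use assms length_le_dsize[of "map of_number (map ((+) k) xs) :: 'a data list"] in simp)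
  ultimately show ?thesis by (rule eval_le_weaken[OF _ refl])
qed

text \<open>\<open>None\<close> is the wildcard.\<close>

definition of_wildcard :: "'a option \<Rightarrow> 'a data" where
  "of_wildcard x = (case x of None \<Rightarrow> Leaf | Some a \<Rightarrow> Sym a)"

definition layer :: "nat \<Rightarrow> nat \<Rightarrow> 'a option \<Rightarrow> (nat \<times> 'a \<times> nat) list \<Rightarrow> (nat \<times> 'a \<times> nat) list" where
  "layer k m x ts =
     map (\<lambda>(p, a, q). (k + p, a, (if x = None \<or> x = Some a then m else 0) + q)) ts"

lemma of_transition_eq: "of_transition (p, a, q) = Node (of_number p) (Node (Sym a) (of_number q))"
  by (simp add: of_transition_def)

lemma of_transition_select [simp]:
  "left (of_transition (p, a, q)) = of_number p"
  "right (of_transition (p, a, q)) = Node (Sym a) (of_number q)"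
  by (simp_all add: of_transition_def)

lemma dsize_of_transition: "dsize (of_transition (p, a, q)) = 2 * p + 2 * q + 5"
  by (simp add: of_transition_def dsize_of_number)

lemma target_correct:
  "eval_le P orc [v, of_number m, of_wildcard x, Node (of_transition (p, a, q)) r, acc] target_expr
     (of_number (if x = None \<or> x = Some a then m else 0)) 20"
proof (cases x)
  case None
  show ?thesis unfolding target_expr_def of_wildcard_def None of_transition_def
    by (rule eval_le_weaken, (rule eval_le_rules eval_le_Cond_false | simp)+)
next
  case (Some b)
  show ?thesis
  proof (cases "a = b")
    case True
    show ?thesis unfolding target_expr_def of_wildcard_def Some of_transition_def
      by (rule eval_le_weaken, (rule eval_le_rules eval_le_Cond_true |
        simp add: of_boolean_def True)+)
  next
    case False
    have eq: "eval_le P orc [v, of_number m, of_wildcard x, Node (of_transition (p, a, q)) r, acc]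
        (Equal (Var 2) (Left (Right (Left (Var 3))))) Leaf 8"
      unfolding of_wildcard_def Some
      by (rule eval_le_weaken[OF eval_le_Equal], (rule eval_le_rules |
        (simp add: of_boolean_def False False[symmetric]; fail))+)
    show ?thesis unfolding target_expr_def
      apply (rule eval_le_weaken[OF eval_le_Cond_true[OF _ _ eval_le_Cond_false[OF eq]]])
             apply (rule eval_le_MkLeaf eval_le_Var | (simp add: Some of_wildcard_def; fail))+
      using False by (simp_all add: Some of_number_def of_wildcard_def)
  qed
qed

definition layer_time :: "nat \<Rightarrow> nat" where
  "layer_time S = (S + 1) * (2 * append_time S + 3 * S + 100)"

lemma layer_correct:
  assumes "dsize (of_list (map of_transition (layer k m x ts @ us))) \<le> S"
  shows "eval_le (prog as) orc [of_number k, of_number m, of_wildcard x,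
      of_list (map of_transition ts), of_list (map of_transition us)] layer_body
    (of_list (map of_transition (layer k m x ts @ us))) (layer_time S)"
proof -
  have "eval_le (prog as) orc [of_number k, of_number m, of_wildcard x,
      of_list (map of_transition ts), of_list (map of_transition us)] layer_body
    (of_list (map of_transition (layer k m x ts @ us)))
    ((length ts + 1) * (2 * append_time S + 3 * S + 100))"
    using assms
  proof (induction ts)
    case Nil
    show ?case unfolding layer_body_def layer_def
      by (rule eval_le_weaken, (rule eval_le_rules eval_le_Cond_false | simp)+)
  next
    case (Cons t ts)
    obtain p a q where t: "t = (p, a, q)" by (cases t)
    let ?m = "if x = None \<or> x = Some a then m else 0"
    have layer: "layer k m x ((p, a, q) # ts) = (k + p, a, ?m + q) # layer k m x ts"
      by (simp add: layer_def)
    have size: "1 + dsize (of_transition (k + p, a, ?m + q)) +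
        dsize (of_list (map of_transition (layer k m x ts @ us))) \<le> S"
      using Cons.prems unfolding t layer by simp
    from Cons have IH: "eval_le (prog as) orc [of_number k, of_number m, of_wildcard x,
      of_list (map of_transition ts), of_list (map of_transition us)] layer_body
      (of_list (map of_transition (layer k m x ts @ us)))
      ((length ts + 1) * (2 * append_time S + 3 * S + 100))"
      using size by linarith
    have app1: "eval_le (prog as) orc [of_number k, of_number p] append_body
       (of_number (k + p)) (append_time S)"
      by (rule append_number_correct) (use size in \<open>simp add: dsize_of_transition dsize_of_number\<close>)
    have app2: "eval_le (prog as) orc [of_number ?m, of_number q] append_body
       (of_number (?m + q)) (append_time S)"
      by (rule append_number_correct) (use size in \<open>simp add: dsize_of_transition dsize_of_number\<close>)
    show ?case
      unfolding layer t list.map append.simps of_list.simps of_transition_eq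
      apply (subst layer_body_def)
      apply (rule eval_le_weaken[OF _ refl])
       apply (rule eval_le_Cond_true eval_le_Call_prog[OF app1 prog_nth(10)]
          eval_le_Call_prog[OF app2 prog_nth(10)] target_correct[unfolded of_transition_eq]
          eval_le_Call_prog[OF IH prog_nth(8)] eval_le_rules | (simp; fail))+
      using size by (simp add: dsize_of_transition dsize_of_number)
  qed
  moreover have "(length ts + 1) * (2 * append_time S + 3 * S + 100) \<le> layer_time S"
    unfolding layer_time_def
    by (rule mult_le_mono1)
      (use assms length_le_dsize[of "map of_transition (layer k m x ts @ us)"]
        in \<open>simp add: layer_def\<close>)
  ultimately show ?thesis by (rule eval_le_weaken[OF _ refl])
qed

text \<open>The states of the product are layers of \<open>n\<close> states each: offset \<open>0\<close> is a rejecting sink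
  layer, offset \<open>n\<close> the layer that accepts the empty suffix of the pattern, and the suffix of
  length \<open>j\<close> has offset \<open>n * (j + 1)\<close>. A transition of \<open>M\<close> that fails to match leads to the sink
  layer, which preserves determinism and completeness.\<close>

primrec transitions :: "nat \<Rightarrow> (nat \<times> 'a \<times> nat) list \<Rightarrow> 'a option list \<Rightarrow> (nat \<times> 'a \<times> nat) list"
  where
    "transitions n ts [] = layer n 0 None ts @ ts"
  | "transitions n ts (x # xs) =
       layer (n * (length xs + 2)) (n * (length xs + 1)) x ts @ transitions n ts xs"

definition transitions_time :: "nat \<Rightarrow> nat" where
  "transitions_time S = (S + 1) * (layer_time S + 2 * offset_time S + 30)"

lemma transitions_correct:
  assumes "dsize (of_list (map of_transition (transitions n ts pat))) \<le> S"
    "dsize (of_number (n * (length pat + 1)) :: 'a data) \<le> S" "length pat \<le> S"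
  shows "eval_le (prog as) orc [of_number n, of_list (map of_transition ts),
      of_list (map of_wildcard pat) :: 'a data] transitions_body
    (of_list (map of_transition (transitions n ts pat))) (transitions_time S)"
proof -
  have "eval_le (prog as) orc [of_number n, of_list (map of_transition ts),
      of_list (map of_wildcard pat)] transitions_body
    (of_list (map of_transition (transitions n ts pat)))
    ((length pat + 1) * (layer_time S + 2 * offset_time S + 30))"
    using assms
  proof (induction pat)
    case Nil
    \<comment> \<open>\<open>Leaf\<close> encodes both the number 0 and the wildcard: here it is the
      offset of the sink layer and then an unrestricted letter.\<close>
    have lay: "eval_le (prog as) orc [of_number n, Leaf, Leaf,
      of_list (map of_transition ts), of_list (map of_transition ts)] layer_body
      (of_list (map of_transition (layer n 0 None ts @ ts))) (layer_time S)"
      using layer_correct[of n 0 None ts ts S as orc] Nil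
      by (simp add: of_number_def of_wildcard_def)
    show ?case unfolding transitions_body_def
      by (rule eval_le_weaken, (rule eval_le_rules eval_le_Cond_false eval_le_Call_prog[OF lay
        prog_nth(8)] | simp)+)
  next
    case (Cons x xs)
    have IH: "eval_le (prog as) orc [of_number n, of_list (map of_transition ts),
        of_list (map of_wildcard xs)] transitions_body
      (of_list (map of_transition (transitions n ts xs)))
      ((length xs + 1) * (layer_time S + 2 * offset_time S + 30))"
    proof (rule Cons.IH)
      have "dsize (of_list us) \<le> dsize (of_list (vs @ us))" for us vs :: "'a data list"
        by (induction vs) auto
      then show "dsize (of_list (map of_transition (transitions n ts xs))) \<le> S"
        using Cons.prems(1) by simp (meson le_trans)
    qed (use Cons.prems in \<open>simp_all add: dsize_of_number\<close>)
    have off1: "eval_le (prog as) orc [of_number n, of_list (map of_wildcard (x # xs))] offset_body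
      (of_number (n * (length xs + 2))) (offset_time S)"
      using offset_correct[of n "map of_wildcard (x # xs)" S as orc] Cons.prems by simp
    have off2: "eval_le (prog as) orc [of_number n, of_list (map of_wildcard xs)] offset_body
      (of_number (n * (length xs + 1))) (offset_time S)"
      using offset_correct[of n "map of_wildcard xs" S as orc] Cons.prems
      by (simp add: dsize_of_number)
    have lay: "eval_le (prog as) orc [of_number (n * (length xs + 2)), of_number (n * (length xs +
      1)),
      of_wildcard x, of_list (map of_transition ts), of_list (map of_transition (transitions n ts
        xs))]
      layer_body (of_list (map of_transition (transitions n ts (x # xs)))) (layer_time S)"
      using layer_correct[of "n * (length xs + 2)" "n * (length xs +
        1)" x ts "transitions n ts xs" S as orc]
        Cons.prems by simp
    show ?case
      apply (subst transitions_body_def)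
      apply (rule eval_le_weaken)
        apply (rule eval_le_Cond_true eval_le_Var | simp)+
        apply (rule eval_le_Call_prog[OF lay prog_nth(8)], simp)
        apply (rule eval_le_Call_prog[OF off1 prog_nth(6)] eval_le_Call_prog[OF off2 prog_nth(6)]
          eval_le_Call_prog[OF IH prog_nth(7)] eval_le_rules | (simp; fail))+
      done
  qed
  moreover have "(length pat + 1) * (layer_time S + 2 * offset_time S + 30) \<le> transitions_time S"
    unfolding transitions_time_def by (rule mult_le_mono1) (use assms in simp)
  ultimately show ?thesis by (rule eval_le_weaken[OF _ refl])
qed

definition encode :: "nat \<Rightarrow> nat list \<Rightarrow> nat list \<Rightarrow> (nat \<times> 'a \<times> nat) list \<Rightarrow> 'a data" where
  "encode n is fs ts = of_list [of_number n, of_list (map of_number is),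
     of_list (map of_number fs), of_list (map of_transition ts)]"

text \<open>Layers are counted by the pattern positions still to be read: runs start in the highest
  layer, at \<open>n * (length pat + 1)\<close>, and accept in the layer at \<open>n\<close>. The
  transitions for a tail of the pattern thus reappear without renumbering.\<close>

definition build :: "nat \<Rightarrow> nat list \<Rightarrow> nat list \<Rightarrow> (nat \<times> 'a \<times> nat) list \<Rightarrow> 'a option list \<Rightarrow> 'a data"
  where
    "build n is fs ts pat = encode (n * (length pat + 2)) (map ((+) (n * (length pat + 1))) is)
       (map ((+) n) fs) (transitions n ts pat)"

definition build_time :: "nat \<Rightarrow> nat" where
  "build_time S = append_time S + 2 * offset_time S + 2 * shift_time S + transitions_time S +
    4 * S + 100"

lemma build_correct:
  assumes "dsize (build n is fs ts pat) \<le> S" "length pat \<le> S"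
  shows "eval_le (prog as) orc [encode n is fs ts, of_list (map of_wildcard pat)] build_body
    (build n is fs ts pat) (build_time S)"
proof -
  note size = assms(1)[unfolded build_def encode_def, simplified]
  have app: "eval_le (prog as) orc [of_number n, of_number (n * (length pat + 1))] append_body
     (of_number (n * (length pat + 2))) (append_time S)"
    using append_number_correct[of n "n * (length pat + 1)" S as orc] size by simp
  have off: "eval_le (prog as) orc [of_number n, of_list (map of_wildcard pat)] offset_body
     (of_number (n * (length pat + 1))) (offset_time S)"
    using offset_correct[of n "map of_wildcard pat" S as orc] size assms(2)
    by (simp add: dsize_of_number)
  have sh1: "eval_le (prog as) orc [of_number (n * (length pat + 1)), of_list (map of_number is)]
     shift_body (of_list (map of_number (map ((+) (n * (length pat + 1))) is))) (shift_time S)"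
    by (rule shift_correct) (use size in simp)
  have sh2: "eval_le (prog as) orc [of_number n, of_list (map of_number fs)]
     shift_body (of_list (map of_number (map ((+) n) fs))) (shift_time S)"
    by (rule shift_correct) (use size in simp)
  have tr: "eval_le (prog as) orc [of_number n, of_list (map of_transition ts),
      of_list (map of_wildcard pat)] transitions_body
    (of_list (map of_transition (transitions n ts pat))) (transitions_time S)"
    by (rule transitions_correct) (use size assms(2) in \<open>simp_all add: dsize_of_number\<close>)
  show ?thesis
    unfolding build_def encode_def of_list.simps
    apply (subst build_body_def)
    apply (rule eval_le_weaken[OF _ refl])
     apply (rule eval_le_Call_prog[OF tr prog_nth(7)] eval_le_Call_prog[OF sh1 prog_nth(9)]
          eval_le_Call_prog[OF sh2 prog_nth(9)] eval_le_Call_prog[OF off prog_nth(6)]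
          eval_le_Call_prog[OF app prog_nth(10)] eval_le_rules | (simp; fail))+
    using size by (simp add: build_time_def)
qed

section \<open>Correctness of the product\<close>

definition acceptor_of :: "nat \<Rightarrow> nat list \<Rightarrow> nat list \<Rightarrow> (nat \<times> 'a \<times> nat) list \<Rightarrow> (nat, 'a) acceptor"
  where "acceptor_of n is fs ts =
    \<lparr>states = {..<n}, init = set is, final = set fs, trans = set ts\<rparr>"

lemma acceptor_of_simps [simp]:
  "states (acceptor_of n is fs ts) = {..<n}" "init (acceptor_of n is fs ts) = set is"
  "final (acceptor_of n is fs ts) = set fs" "trans (acceptor_of n is fs ts) = set ts"
  by (simp_all add: acceptor_of_def)

text \<open>Runs depend on the transition list alone; leaving out the acceptor allows runs for a
  pattern and for its tail to be compared directly.\<close>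

primrec walk :: "(nat \<times> 'a \<times> nat) list \<Rightarrow> nat \<Rightarrow> 'a list \<Rightarrow> nat \<Rightarrow> bool" where
  "walk ts p [] q \<longleftrightarrow> p = q"
| "walk ts p (a # w) q \<longleftrightarrow> (\<exists>r. (p, a, r) \<in> set ts \<and> walk ts r w q)"

lemma path_acceptor_of: "path (acceptor_of n is fs ts) p w q \<longleftrightarrow> walk ts p w q"
  by (induction w arbitrary: p) auto

definition matches :: "'a option list \<Rightarrow> 'a list \<Rightarrow> bool" where
  "matches = list_all2 (\<lambda>x a. x = None \<or> x = Some a)"

lemma matches_simps [simp]:
  "matches [] w \<longleftrightarrow> w = []" "matches (x # xs) [] \<longleftrightarrow> False"
  "matches (x # xs) (a # w) \<longleftrightarrow> (x = None \<or> x = Some a) \<and> matches xs w"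
  by (simp_all add: matches_def)

section \<open>Walks through the layers\<close>

definition bounded_trans :: "nat \<Rightarrow> (nat \<times> 'a \<times> nat) list \<Rightarrow> bool" where
  "bounded_trans n ts \<longleftrightarrow> set ts \<subseteq> {..<n} \<times> UNIV \<times> {..<n}"

lemma bounded_transD:
  "bounded_trans n ts \<Longrightarrow> (p, a, q) \<in> set ts \<Longrightarrow> p < n"
  "bounded_trans n ts \<Longrightarrow> (p, a, q) \<in> set ts \<Longrightarrow> q < n"
  by (auto simp: bounded_trans_def)

lemma bounded_trans_append:
  "bounded_trans n (ts @ us) \<longleftrightarrow> bounded_trans n ts \<and> bounded_trans n us"
  by (simp add: bounded_trans_def)

lemma in_layer:
  "(r, a, r') \<in> set (layer k m x ts) \<longleftrightarrow>
     (\<exists>p q. (p, a, q) \<in> set ts \<and> r = k + p \<and> r' = (if x = None \<or> x = Some a then m else 0) + q)"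
  by (force simp: layer_def)

lemma bounded_layer:
  assumes "bounded_trans n ts" "k + n \<le> l" "m + n \<le> l"
  shows "bounded_trans l (layer k m x ts)"
  using assms by (fastforce simp: bounded_trans_def layer_def)

lemma bounded_transitions:
  assumes "bounded_trans n ts"
  shows "bounded_trans (n * (length pat + 2)) (transitions n ts pat)"
proof (induction pat)
  case Nil
  have "bounded_trans (n * 2) ts" using assms by (fastforce simp: bounded_trans_def)
  moreover have "bounded_trans (n * 2) (layer n 0 None ts)"
    by (rule bounded_layer[OF assms]) auto
  ultimately show ?case by (simp add: bounded_trans_append mult_2_right[symmetric])
next
  case (Cons x xs)
  have "bounded_trans (n * (length (x # xs) + 2)) (transitions n ts xs)"
    using Cons by (fastforce simp: bounded_trans_def)
  moreover have "bounded_trans (n * (length (x # xs) + 2))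
      (layer (n * (length xs + 2)) (n * (length xs + 1)) x ts)"
    by (rule bounded_layer[OF assms]) auto
  ultimately show ?case by (simp add: bounded_trans_append)
qed

text \<open>All transitions for the tail start below \<open>n * (length xs + 2)\<close>, so only the
  newly added ones leave a state of the top layer.\<close>

lemma transitions_head:
  assumes "bounded_trans n ts" "p < n"
  shows "(n * (length xs + 2) + p, a, r) \<in> set (transitions n ts (x # xs)) \<longleftrightarrow>
    (\<exists>q. (p, a, q) \<in> set ts \<and> r = (if x = None \<or> x = Some a then n * (length xs + 1) else 0) + q)"
  using bounded_transD(1)[OF bounded_transitions[OF assms(1), of xs]]
  by (fastforce simp: in_layer)

lemma transitions_tail:
  assumes "r < n * (length xs + 2)"
  shows "(r, a, r') \<in> set (transitions n ts (x # xs)) \<longleftrightarrow> (r, a, r') \<in> set (transitions n ts xs)"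
  using assms by (auto simp: in_layer)

lemma transitions_final:
  assumes "bounded_trans n ts"
  shows "(n + p, a, r) \<in> set (transitions n ts []) \<longleftrightarrow> (p, a, r) \<in> set ts"
  using bounded_transD(1)[OF assms] by (auto simp: in_layer)

lemma transitions_sink:
  assumes "r < n"
  shows "(r, a, r') \<in> set (transitions n ts pat) \<longleftrightarrow> (r, a, r') \<in> set ts"
proof (induction pat)
  case Nil
  show ?case using assms by (auto simp: in_layer)
next
  case (Cons x xs)
  have "r < n * (length xs + 2)" using assms by simp
  with Cons show ?case by (simp add: transitions_tail del: transitions.simps)
qed

text \<open>The sink layer carries an unshifted copy of the transitions of \<open>M\<close> and is
  closed under them. As final states are shifted by \<open>n\<close>, a mismatch can never be
  repaired.\<close>

lemma walk_sink:
  assumes "bounded_trans n ts"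
  shows "r < n \<Longrightarrow> walk (transitions n ts pat) r w r' \<Longrightarrow> r' < n"
  by (induction w arbitrary: r) (use assms in \<open>auto simp: transitions_sink dest: bounded_transD(2)\<close>)

text \<open>No transition leads to a higher layer, so a walk that starts below the top layer never
  meets it.\<close>

lemma walk_tail:
  assumes "bounded_trans n ts"
  shows "r < n * (length xs + 2) \<Longrightarrow>
    walk (transitions n ts (x # xs)) r w r' \<longleftrightarrow> walk (transitions n ts xs) r w r'"
proof (induction w arbitrary: r)
  case (Cons a w)
  then show ?case
    using bounded_transD(2)[OF bounded_transitions[OF assms, of xs]] transitions_tail[OF Cons.prems]
    by (auto simp del: transitions.simps)
qed simp

text \<open>Each matching letter lowers the layer by one and each mismatch falls into the sink,
  while the position within the layer follows a run of \<open>M\<close>; the layer at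
  \<open>n\<close> is therefore reached exactly when the whole pattern has been matched.\<close>

lemma walk_transitions:
  assumes "bounded_trans n ts"
  shows "p < n \<Longrightarrow> f < n \<Longrightarrow> walk (transitions n ts pat) (n * (length pat + 1) + p) w (n + f)
    \<longleftrightarrow> matches pat w \<and> walk ts p w f"
proof (induction pat arbitrary: p w)
  case Nil
  show ?case
  proof (cases w)
    case (Cons a w')
    have "\<not> walk (transitions n ts []) r w' (n + f)" if "(p, a, r) \<in> set ts" for r
      using walk_sink[OF assms bounded_transD(2)[OF assms that]] by fastforce
    then show ?thesis using Nil Cons transitions_final[OF assms, of p a]
      by (auto simp del: transitions.simps)
  qed (use Nil in auto)
next
  case (Cons x xs)
  show ?case
  proof (cases w)
    case Nil
    have "n * (length xs + 2) + p \<noteq> n + f" using Cons.prems by simp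
    then show ?thesis using Nil by simp
  next
    case (Cons a w')
    let ?m = "if x = None \<or> x = Some a then n * (length xs + 1) else 0"
    have "walk (transitions n ts (x # xs)) (?m + q) w' (n + f) \<longleftrightarrow>
        (x = None \<or> x = Some a) \<and> matches xs w' \<and> walk ts q w' f"
      if "(p, a, q) \<in> set ts" for q
    proof (cases "x = None \<or> x = Some a")
      case True
      have q: "q < n" using bounded_transD(2)[OF assms that] .
      then have "n * (length xs + 1) + q < n * (length xs + 2)" by simp
      from walk_tail[OF assms this] Cons.IH[OF q \<open>f < n\<close>] True show ?thesis by simp
    next
      case False
      then show ?thesis
        using walk_sink[OF assms bounded_transD(2)[OF assms that], of "x # xs" w' "n + f"] by auto
    qed
    moreover have "walk (transitions n ts (x # xs)) (n * (length (x # xs) + 1) + p) w (n + f) \<longleftrightarrow>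
        (\<exists>q. (p, a, q) \<in> set ts \<and> walk (transitions n ts (x # xs)) (?m + q) w' (n + f))"
      using transitions_head[OF assms \<open>p < n\<close>, of xs a _ x]
      by (auto simp: Cons simp del: transitions.simps)
    ultimately show ?thesis by (auto simp: Cons simp del: transitions.simps)
  qed
qed

definition restrict :: "nat \<Rightarrow> nat list \<Rightarrow> nat list \<Rightarrow> (nat \<times> 'a \<times> nat) list \<Rightarrow> 'a option list
    \<Rightarrow> (nat, 'a) acceptor" where
  "restrict n is fs ts pat = acceptor_of (n * (length pat + 2))
     (map ((+) (n * (length pat + 1))) is) (map ((+) n) fs) (transitions n ts pat)"

lemma nfa_acceptor_of:
  "nfa (acceptor_of n is fs ts) \<longleftrightarrow> set is \<subseteq> {..<n} \<and> set fs \<subseteq> {..<n} \<and> bounded_trans n ts"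
  by (simp add: nfa_def bounded_trans_def)

lemma lang_restrict:
  assumes "nfa (acceptor_of n is fs ts)"
  shows "lang (restrict n is fs ts pat) = {w \<in> lang (acceptor_of n is fs ts). matches pat w}"
proof (rule set_eqI)
  fix w
  have bounded: "bounded_trans n ts" "\<And>p. p \<in> set is \<Longrightarrow> p < n" "\<And>f. f \<in> set fs \<Longrightarrow> f < n"
    using assms by (auto simp: nfa_acceptor_of)
  have "w \<in> lang (restrict n is fs ts pat) \<longleftrightarrow> (\<exists>p\<in>set is. \<exists>f\<in>set fs.
      walk (transitions n ts pat) (n * (length pat + 1) + p) w (n + f))"
    unfolding lang_def restrict_def path_acceptor_of by simp
  also have "\<dots> \<longleftrightarrow> (\<exists>p\<in>set is. \<exists>f\<in>set fs. matches pat w \<and> walk ts p w f)"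
    using walk_transitions[OF bounded(1)] bounded(2,3) by (intro bex_cong refl) blast
  also have "\<dots> \<longleftrightarrow> w \<in> {w \<in> lang (acceptor_of n is fs ts). matches pat w}"
    unfolding lang_def path_acceptor_of by auto
  finally show "w \<in> lang (restrict n is fs ts pat) \<longleftrightarrow>
    w \<in> {w \<in> lang (acceptor_of n is fs ts). matches pat w}" .
qed

section \<open>The product stays in the class of the given acceptor\<close>

lemma nfa_restrict:
  assumes "nfa (acceptor_of n is fs ts)"
  shows "nfa (restrict n is fs ts pat)"
  using assms bounded_transitions[of n ts pat] unfolding nfa_acceptor_of restrict_def
  by (auto simp: trans_less_add1)

text \<open>Every state lies in exactly one layer, and a layer only redirects the transitions of
  \<open>M\<close>, never removing or duplicating one.\<close>

lemma total_transitions: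
  assumes "bounded_trans n ts" "\<forall>p<n. \<forall>a. \<exists>!q. (p, a, q) \<in> set ts"
  shows "r < n * (length pat + 2) \<Longrightarrow> \<exists>!r'. (r, a, r') \<in> set (transitions n ts pat)"
proof (induction pat)
  case Nil
  show ?case
  proof (cases "r < n")
    case True
    show ?thesis unfolding transitions_sink[OF True] by (rule assms(2)[rule_format, OF True])
  next
    case False
    then obtain p where r: "r = n + p" using le_Suc_ex[of n r] by auto
    then have "p < n" using Nil by simp
    show ?thesis unfolding r transitions_final[OF assms(1)]
      by (rule assms(2)[rule_format, OF \<open>p < n\<close>])
  qed
next
  case (Cons x xs)
  show ?case
  proof (cases "r < n * (length xs + 2)")
    case True
    then show ?thesis unfolding transitions_tail[OF True] by (rule Cons.IH)
  next
    case False
    then obtain p where r: "r = n * (length xs + 2) + p"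
      using le_Suc_ex[of "n * (length xs + 2)" r] by auto
    then have "p < n" using Cons.prems by simp
    have "\<exists>!q. (p, a, q) \<in> set ts" by (rule assms(2)[rule_format, OF \<open>p < n\<close>])
    then show ?thesis unfolding r transitions_head[OF assms(1) \<open>p < n\<close>] by blast
  qed
qed

lemma dfa_restrict:
  assumes "dfa (acceptor_of n is fs ts)"
  shows "dfa (restrict n is fs ts pat)"
proof -
  have nfa: "nfa (acceptor_of n is fs ts)" using assms by (simp add: dfa_def)
  obtain q where "set is = {q}" using assms unfolding dfa_def acceptor_of_simps by blast
  then have "\<exists>!q. q \<in> set (map ((+) k) is)" for k by simp
  moreover have "\<forall>p<n. \<forall>a. \<exists>!q. (p, a, q) \<in> set ts" using assms by (simp add: dfa_def)
  then have "\<exists>!r'. (r, a, r') \<in> set (transitions n ts pat)" if "r < n * (length pat + 2)" for r a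
    using total_transitions[of n ts] nfa that by (simp add: nfa_acceptor_of)
  ultimately show ?thesis
    using nfa_restrict[OF nfa] by (simp only: dfa_def restrict_def acceptor_of_simps lessThan_iff
      Ball_def) simp
qed

section \<open>Encodings of acceptors and their sizes\<close>

lemma distinct_layer: "distinct ts \<Longrightarrow> distinct (layer k m x ts)"
  by (auto simp: layer_def distinct_map intro!: inj_onI)

text \<open>Required because \<open>describes\<close> admits only repetition-free lists. Different
  layers have disjoint sets of source states.\<close>

lemma distinct_transitions:
  assumes "bounded_trans n ts" "distinct ts"
  shows "distinct (transitions n ts pat)"
proof (induction pat)
  case Nil
  have "r < n" if "(r, a, r') \<in> set ts" for r a r'
    using bounded_transD(1)[OF assms(1) that] .
  then have "set (layer n 0 None ts) \<inter> set ts = {}"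
    by (fastforce simp: layer_def)
  then show ?case using assms by (simp add: distinct_layer)
next
  case (Cons x xs)
  have "r < n * (length xs + 2)" if "(r, a, r') \<in> set (transitions n ts xs)" for r a r'
    using bounded_transD(1)[OF bounded_transitions[OF assms(1)] that] .
  then have "set (layer (n * (length xs + 2)) (n * (length xs +
    1)) x ts) \<inter> set (transitions n ts xs) = {}"
    by (fastforce simp: layer_def simp del: add_2_eq_Suc' mult_Suc_right)
  then show ?case using assms Cons by (simp add: distinct_layer)
qed

lemma describes_encode:
  assumes "distinct is" "distinct fs" "distinct ts"
  shows "describes (encode n is fs ts) (acceptor_of n is fs ts)"
  unfolding describes_def encode_def
  using assms by (intro exI[of _ id] exI[of _ "is"] exI[of _ fs] exI[of _ ts]) auto

lemma describes_build:
  assumes "nfa (acceptor_of n is fs ts)" "distinct is" "distinct fs" "distinct ts"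
  shows "describes (build n is fs ts pat) (restrict n is fs ts pat)"
  unfolding build_def restrict_def
  using assms distinct_transitions
  by (intro describes_encode) (auto simp: distinct_map nfa_acceptor_of)

text \<open>An injective numbering merges no two source states, so unique successors stay
  unique.\<close>

lemma dfa_acceptor_of_rename:
  assumes "dfa M" "bij_betw \<nu> (states M) {..<n}" "set is = \<nu> ` init M" "set fs = \<nu> ` final M"
    and ts: "set ts = (\<lambda>(p, a, q). (\<nu> p, a, \<nu> q)) ` trans M"
    and nfa: "nfa (acceptor_of n is fs ts)"
  shows "dfa (acceptor_of n is fs ts)"
proof -
  obtain q where "init M = {q}" using assms(1) unfolding dfa_def by blast
  then have "\<exists>!q. q \<in> set is" by (simp add: assms(3))
  moreover have "\<exists>!r'. (r, a, r') \<in> set ts" if r: "r < n" for r a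
  proof -
    obtain p where p: "p \<in> states M" "r = \<nu> p" using assms(2) r by (auto simp: bij_betw_def)
    then obtain q where q: "(p, a, q) \<in> trans M" and uniq: "\<And>q'. (p, a, q') \<in> trans M \<Longrightarrow> q' = q"
      using assms(1) unfolding dfa_def by metis
    have M: "nfa M" using assms(1) by (simp add: dfa_def)
    have "r' = \<nu> q" if r': "(r, a, r') \<in> set ts" for r'
    proof -
      obtain p' q' where "(p', a, q') \<in> trans M" "r = \<nu> p'" "r' = \<nu> q'"
        using r' unfolding ts by auto
      moreover from this have "p' = p"
        using inj_onD[OF bij_betw_imp_inj_on[OF assms(2)]] p M by (auto simp: nfa_def subset_iff)
      ultimately show ?thesis using uniq by blast
    qed
    moreover have "(r, a, \<nu> q) \<in> set ts" using q p unfolding ts by force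
    ultimately show ?thesis by blast
  qed
  ultimately show ?thesis using nfa by (simp add: dfa_def)
qed

text \<open>Replaces \<open>M\<close> by a copy on an initial segment of the numbers whose
  components are the very lists in the input, so that the remaining argument can work with
  lists.\<close>

lemma describes_obtain:
  assumes "C \<in> {nfa, dfa}" "C M" "describes d M"
  obtains "is" fs ts where "d = encode (card (states M)) is fs ts"
    "C (acceptor_of (card (states M)) is fs ts)"
    "distinct is" "distinct fs" "distinct ts"
    "lang (acceptor_of (card (states M)) is fs ts) = lang M"
proof -
  have M: "nfa M" using assms by (auto simp: dfa_def)
  obtain \<nu> "is" fs ts where \<nu>: "bij_betw \<nu> (states M) {..<card (states M)}"
    "set is = \<nu> ` init M" "set fs = \<nu> ` final M"
    "set ts = (\<lambda>(p, a, q). (\<nu> p, a, \<nu> q)) ` trans M"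
    and dist: "distinct is" "distinct fs" "distinct ts"
    and d: "d = encode (card (states M)) is fs ts"
    using assms(3) unfolding describes_def encode_def by blast
  let ?A = "acceptor_of (card (states M)) is fs ts"
  have \<nu>_lt: "\<nu> p < card (states M)" if "p \<in> states M" for p
    using \<nu>(1) that by (auto simp: bij_betw_def)
  have A: "nfa ?A"
    unfolding nfa_acceptor_of bounded_trans_def \<nu>(2-4)
  proof (intro conjI subsetI)
    fix x assume "x \<in> (\<lambda>(p, a, q). (\<nu> p, a, \<nu> q)) ` trans M"
    then obtain p a q where "(p, a, q) \<in> trans M" "x = (\<nu> p, a, \<nu> q)" by auto
    moreover from this have "p \<in> states M" "q \<in> states M" using M by (auto simp: nfa_def)
    ultimately show "x \<in> {..<card (states M)} \<times> UNIV \<times> {..<card (states M)}"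
      by (simp add: \<nu>_lt)
  qed (use M \<nu>_lt in \<open>auto simp: nfa_def\<close>)
  then have "C ?A" using assms(1,2) dfa_acceptor_of_rename[OF _ \<nu> A] by blast
  moreover have "lang ?A = lang M"
    by (rule lang_rename[OF M]) (use \<nu> in \<open>auto simp: bij_betw_def\<close>)
  ultimately show ?thesis using that d dist by blast
qed

text \<open>Here \<open>s\<close> is the size of the alphabet. Two lists have at most
  \<open>n\<close> states of size at most \<open>2 * n + 1\<close>, and one has at most
  \<open>n * (s * n)\<close> transitions of size at most \<open>4 * n + 5\<close>; each entry costs
  one more for its list cell. The term \<open>2 * n + 6\<close> is the number of states together
  with the outer list.\<close>

definition size_bound :: "nat \<Rightarrow> nat \<Rightarrow> nat" where
  "size_bound s n = (n * (2 * n + 1 + 1) + 1) + (n * (2 * n + 1 + 1) + 1) +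
    (n * (s * n) * (4 * n + 5 + 1) + 1) + 2 * n + 6"

lemma dsize_of_list_le:
  assumes "\<And>x. x \<in> set xs \<Longrightarrow> dsize (f x) \<le> b" "length xs \<le> m"
  shows "dsize (of_list (map f xs)) \<le> m * (b + 1) + 1"
proof -
  have "dsize (of_list (map f xs)) \<le> length xs * (b + 1) + 1"
    using assms(1) by (induction xs) fastforce+
  also have "\<dots> \<le> m * (b + 1) + 1" by (intro add_le_mono1 mult_le_mono1 assms(2))
  finally show ?thesis .
qed

text \<open>Freedom from repetition turns the cardinalities of the sets of states and transitions
  into bounds on the lengths of the lists.\<close>

lemma dsize_encode_le:
  fixes ts :: "(nat \<times> 'a :: finite \<times> nat) list"
  assumes "nfa (acceptor_of n is fs ts)" "distinct is" "distinct fs" "distinct ts"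
  shows "dsize (encode n is fs ts) \<le> size_bound (card (UNIV :: 'a set)) n"
proof -
  have states: "dsize (of_list (map of_number xs) :: 'a data) \<le> n * (2 * n + 1 + 1) + 1"
    if "set xs \<subseteq> {..<n}" "distinct xs" for xs
  proof (rule dsize_of_list_le)
    show "length xs \<le> n" using that card_mono[of "{..<n}" "set xs"] by (simp add: distinct_card)
    show "dsize (of_number x :: 'a data) \<le> 2 * n + 1" if "x \<in> set xs" for x
      using that \<open>set xs \<subseteq> {..<n}\<close> unfolding dsize_of_number by fastforce
  qed
  have ts: "dsize (of_list (map of_transition ts))
      \<le> n * (card (UNIV :: 'a set) * n) * (4 * n + 5 + 1) + 1"
  proof (rule dsize_of_list_le)
    have "set ts \<subseteq> {..<n} \<times> UNIV \<times> {..<n}" using assms(1)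
      by (simp add: nfa_acceptor_of bounded_trans_def)
    then have "card (set ts) \<le> card ({..<n} \<times> (UNIV :: 'a set) \<times> {..<n})"
      by (intro card_mono) auto
    then show "length ts \<le> n * (card (UNIV :: 'a set) * n)"
      using assms(4) by (simp add: distinct_card card_cartesian_product)
    show "dsize (of_transition t) \<le> 4 * n + 5" if "t \<in> set ts" for t
    proof -
      obtain p a q where t: "t = (p, a, q)" by (cases t)
      then have "p < n" "q < n"
        using bounded_transD[of n ts p a q] assms(1) that by (simp_all add: nfa_acceptor_of)
      then show ?thesis by (simp add: t dsize_of_transition)
    qed
  qed
  have "dsize (encode n is fs ts) = dsize (of_list (map of_number is) :: 'a data) +
      dsize (of_list (map of_number fs) :: 'a data) + dsize (of_list (map of_transition ts)) +
        2 * n + 6"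
    by (simp add: encode_def dsize_of_number)
  also have "\<dots> \<le> size_bound (card (UNIV :: 'a set)) n"
    unfolding size_bound_def
    by (intro add_mono le_refl states ts) (use assms in \<open>simp_all add: nfa_acceptor_of\<close>)
  finally show ?thesis .
qed

section \<open>Short counterexamples\<close>

lemma path_append: "path M p (u @ v) q \<longleftrightarrow> (\<exists>r. path M p u r \<and> path M r v q)"
  by (induction u arbitrary: p) auto

lemma path_states: "nfa M \<Longrightarrow> p \<in> states M \<Longrightarrow> path M p w q \<Longrightarrow> q \<in> states M"
  by (induction w arbitrary: p) (auto simp: nfa_def)

lemma dfa_path_unique:
  "dfa M \<Longrightarrow> p \<in> states M \<Longrightarrow> path M p w q \<Longrightarrow> path M p w q' \<Longrightarrow> q = q'"
proof (induction w arbitrary: p)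
  case (Cons a w)
  then obtain r r' where r: "(p, a, r) \<in> trans M" "path M r w q"
    and r': "(p, a, r') \<in> trans M" "path M r' w q'" by auto
  have "r = r'" using Cons.prems(1,2) r(1) r'(1) unfolding dfa_def by blast
  moreover have "r \<in> states M" using Cons.prems(1) r(1) by (auto simp: dfa_def nfa_def)
  ultimately show ?case using Cons.IH[OF Cons.prems(1)] r(2) r'(2) by blast
qed simp

lemma dfa_path_exists:
  "dfa M \<Longrightarrow> p \<in> states M \<Longrightarrow> \<exists>q\<in>states M. path M p w q"
proof (induction w arbitrary: p)
  case (Cons a w)
  then obtain r where r: "(p, a, r) \<in> trans M" unfolding dfa_def by blast
  then have "r \<in> states M" using Cons.prems(1) by (auto simp: dfa_def nfa_def)
  with Cons r show ?case by force
qed simp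

text \<open>Cutting out the factor between two equal pairs of states keeps acceptance by
  \<open>M\<close>, which may be nondeterministic; that it also keeps rejection by \<open>T\<close>
  rests on the determinism of \<open>T\<close>.\<close>

lemma short_counterexample:
  assumes M: "nfa M" and T: "dfa T" and u: "u \<in> lang M - lang T"
  shows "\<exists>v\<in>lang M - lang T. length v < card (states M) * card (states T)"
  using u
proof (induction u rule: length_induct)
  case (1 u)
  show ?case
  proof (cases "length u < card (states M) * card (states T)")
    case False
    obtain p f where p: "p \<in> init M" and f: "f \<in> final M" and pf: "path M p u f"
      using 1 by (auto simp: lang_def)
    obtain i where i: "init T = {i}" using T unfolding dfa_def by blast
    have states: "finite (states M)" "finite (states T)" "p \<in> states M" "i \<in> states T"
      using M T p i by (auto simp: nfa_def dfa_def)
    have "\<exists>r. path M p (take k u) r \<and> path M r (drop k u) f" for k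
      using pf path_append[of M p "take k u" "drop k u" f] by simp
    \<comment> \<open>The states \<open>r k\<close> are chosen separately for each \<open>k\<close>
      and need not lie on one run. Cutting only needs that \<open>r k\<close> is reached by the
      first \<open>k\<close> letters and accepts the rest.\<close>
    then obtain r where r: "\<And>k. path M p (take k u) (r k)" "\<And>k. path M (r k) (drop k u) f"
      by metis
    obtain s where s: "\<And>k. s k \<in> states T" "\<And>k. path T i (take k u) (s k)"
    proof -
      have "\<forall>k. \<exists>q. q \<in> states T \<and> path T i (take k u) q"
        using dfa_path_exists[OF T states(4)] by blast
      then show thesis using that by metis
    qed
    let ?g = "\<lambda>k. (r k, s k)"
    have "?g ` {..length u} \<subseteq> states M \<times> states T"
      using path_states[OF M states(3) r(1)] s(1) by auto
    then have "card (?g ` {..length u}) \<le> card (states M) * card (states T)"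
      using states card_mono[of "states M \<times> states T"] by (simp add: card_cartesian_product)
    \<comment> \<open>There are \<open>length u + 1\<close> positions, one more than
      letters.\<close>
    then have "card (?g ` {..length u}) < card {..length u}" using False by simp
    then have "\<not> inj_on ?g {..length u}" by (rule pigeonhole)
    then obtain j k where jk: "j < k" "k \<le> length u" "r j = r k" "s j = s k"
      unfolding inj_on_def by (metis atMost_iff linorder_neqE_nat prod.inject)
    let ?v = "take j u @ drop k u"
    have "?v \<in> lang M"
      using p f path_append r(1)[of j] r(2)[of k] jk(3) unfolding lang_def by force
    moreover have "?v \<notin> lang T"
    proof
      assume "?v \<in> lang T"
      then obtain f' s' where f': "f' \<in> final T" "path T i (take j u) s'" "path T s' (drop k u) f'"
        using i path_append by (fastforce simp: lang_def)
      \<comment> \<open>\<open>T\<close> is in the same state after both prefixes, so accepting the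
        shortened word would mean accepting \<open>u\<close>.\<close>
      then have "s' = s k" using dfa_path_unique[OF T states(4)] s(2) jk(4) by metis
      then have "path T i (take k u @ drop k u) f'" using f'(3) s(2) path_append by metis
      then have "u \<in> lang T" using i f'(1) by (auto simp: lang_def)
      with 1 show False by blast
    qed
    moreover have "length ?v < length u" using jk by simp
    ultimately show ?thesis using 1 by blast
  qed (use 1 in blast)
qed

section \<open>Search for a counterexample\<close>

lemma matches_map_Some: "matches (map Some w) u \<longleftrightarrow> u = w"
proof (induction w arbitrary: u)
  case (Cons a w)
  then show ?case by (cases u) auto
qed simp

lemma matches_wildcards:
  "matches (replicate k None @ map Some w) u \<longleftrightarrow> (\<exists>v. length v = k \<and> u = v @ w)"
proof (induction k arbitrary: u)
  case 0
  then show ?case by (simp add: matches_map_Some)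
next
  case (Suc k)
  then show ?case by (cases u) (auto simp: length_Suc_conv)
qed

lemma dsize_of_word: "dsize (of_word w) = 2 * length w + 1"
  unfolding of_word_def by (induction w) auto

text \<open>The bound \<open>c\<close> stays fixed in the induction, so that each letter has the
  same cost although the tree grows.\<close>

lemma letters_correct:
  "length xs \<le> c \<Longrightarrow> eval_le P orc env (letters_expr xs) (of_word xs) (length xs * (2 * c + 5) + 1)"
proof (induction xs)
  case Nil
  show ?case using eval_le_MkLeaf[of P orc env] by (simp add: letters_expr_def of_word_def)
next
  case (Cons a xs)
  then have IH: "eval_le P orc env (letters_expr xs) (of_word xs) (length xs * (2 * c + 5) + 1)"
    by simp
  have eq: "letters_expr (a # xs) = MkNode (MkSym a) (letters_expr xs)"
    by (simp add: letters_expr_def)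
  show ?case unfolding eq
    by (rule eval_le_weaken[OF eval_le_MkNode[OF eval_le_MkSym IH]])
      (use Cons.prems dsize_of_word[of xs] in \<open>simp_all add: of_word_def\<close>)
qed

definition step_time :: "nat \<Rightarrow> nat" where
  "step_time S = build_time S + append_time S + 4 * S + 100"

definition complete_time :: "nat \<Rightarrow> nat \<Rightarrow> nat" where
  "complete_time c S = c * step_time S + c * (2 * c + 5) + 50"

text \<open>At most \<open>m + 1\<close> lengths are tried and at most \<open>m\<close> letters are
  determined; the other terms cover the first query.\<close>

definition total_time :: "nat \<Rightarrow> nat \<Rightarrow> nat \<Rightarrow> nat" where
  "total_time c S m = (m + 1) * step_time S + m * complete_time c S + 2 * S + 60"

text \<open>\<open>m\<close> limits the lengths that are tried and \<open>S\<close> the trees that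
  are built. A counterexample of length \<open>m\<close> is not assumed here, so both outcomes of
  the first query are covered.\<close>

locale search =
  fixes C :: "(nat, 'a) acceptor \<Rightarrow> bool" and L :: "'a list set" and letters :: "'a list"
    and n :: nat and "is" fs :: "nat list" and ts :: "(nat \<times> 'a \<times> nat) list"
    and m S :: nat
  assumes letters: "set letters = UNIV"
    and C: "C \<in> {nfa, dfa}" "C (acceptor_of n is fs ts)"
    and distinct: "distinct is" "distinct fs" "distinct ts"
    and size_input: "dsize (encode n is fs ts) \<le> S"
    and size_build: "length pat \<le> m \<Longrightarrow> dsize (build n is fs ts pat) \<le> S"
    and size_word: "2 * m + 1 \<le> S"
begin

abbreviation "evaluates env e v b \<equiv> eval_le (prog letters) (restricted_subset_query C L) env e v b"

abbreviation "input \<equiv> encode n is fs ts"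

definition counterexample :: "'a list \<Rightarrow> bool" where
  "counterexample u \<longleftrightarrow> u \<in> lang (acceptor_of n is fs ts) - L"

text \<open>This is the negative answer to the query for \<open>k\<close> wildcards followed by
  \<open>w\<close>, as \<open>query_answer\<close> shows.\<close>

definition refuted :: "nat \<Rightarrow> 'a list \<Rightarrow> bool" where
  "refuted k w \<longleftrightarrow> (\<exists>v. length v = k \<and> counterexample (v @ w))"

definition wildcards :: "nat \<Rightarrow> 'a data" where
  "wildcards k = of_list (replicate k Leaf)"

lemma wildcards_simps [simp]:
  "wildcards 0 = Leaf" "wildcards (Suc k) = Node Leaf (wildcards k)"
  by (simp_all add: wildcards_def)

lemma of_word_simps [simp]:
  "of_word [] = Leaf" "of_word (a # w) = Node (Sym a) (of_word w)"
  by (simp_all add: of_word_def)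

definition query :: "nat \<Rightarrow> 'a list \<Rightarrow> 'a data" where
  "query k w = build n is fs ts (replicate k None @ map Some w)"

definition pattern :: "nat \<Rightarrow> 'a list \<Rightarrow> 'a data" where
  "pattern k w = of_list (replicate k Leaf @ map Sym w)"

lemma dsize_query: "k + length w \<le> m \<Longrightarrow> dsize (query k w) \<le> S"
  unfolding query_def by (rule size_build) simp

lemma query_answer: "restricted_subset_query C L (query k w) (\<not> refuted k w)"
proof -
  let ?pat = "replicate k None @ map Some w"
  have nfa: "nfa (acceptor_of n is fs ts)" using C by (auto simp: dfa_def)
  then have "C (restrict n is fs ts ?pat)"
    using C nfa_restrict dfa_restrict by auto
  moreover have "describes (query k w) (restrict n is fs ts ?pat)"
    unfolding query_def by (rule describes_build[OF nfa distinct])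
  moreover have "lang (restrict n is fs ts ?pat) \<subseteq> L \<longleftrightarrow> \<not> refuted k w"
    unfolding lang_restrict[OF nfa] matches_wildcards refuted_def counterexample_def by blast
  ultimately show ?thesis unfolding restricted_subset_query_def by blast
qed

lemma input_answer:
  "restricted_subset_query C L input (lang (acceptor_of n is fs ts) \<subseteq> L)"
  unfolding restricted_subset_query_def using C(2) describes_encode[OF distinct] by blast

lemma build_pattern:
  assumes "k + length w \<le> m"
  shows "evaluates [input, pattern k w] build_body (query k w) (build_time S)"
proof -
  have eq: "map of_wildcard (replicate k None @ map Some w) = replicate k Leaf @ map Sym w"
    by (simp add: of_wildcard_def)
  show ?thesis
    unfolding query_def pattern_def eq[symmetric]
    by (rule build_correct) (use assms size_build size_word in simp_all)
qed

lemma append_pattern: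
  assumes "k + length w \<le> m"
  shows "evaluates [wildcards k, of_word w] append_body (pattern k w) (append_time S)"
proof -
  have "dsize (of_list (replicate k Leaf @ map Sym w)) = 2 * k + 2 * length w + 1"
    by (induction k) (use dsize_of_word[of w] in \<open>auto simp: of_word_def\<close>)
  then show ?thesis
    using append_correct[of "replicate k Leaf" "map Sym w" S] assms size_word
    by (simp add: wildcards_def of_word_def pattern_def)
qed

text \<open>\<open>try_body\<close> and \<open>complete_body\<close> call each other. Taking the
  behaviour of the latter as a hypothesis separates the induction on candidates from that on
  wildcards.\<close>

lemma try_correct:
  assumes complete: "\<And>b. refuted k (b # w) \<Longrightarrow> \<exists>u. counterexample u \<and>
      evaluates [input, wildcards k, of_word (b # w)] (complete_body letters) (no_answer u) t"
    and "k + length w < m"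
  shows "\<exists>b\<in>set bs. refuted k (b # w) \<Longrightarrow> \<exists>u. counterexample u \<and>
    evaluates [input, wildcards k, of_word w, of_word bs] try_body (no_answer u)
      (length bs * step_time S + t)"
proof (induction bs)
  case (Cons b bs)
  have len: "k + length (b # w) \<le> m" using assms(2) by simp
  have node: "dsize (of_word (b # w)) \<le> S" using len size_word by (simp add: dsize_of_word)
  have app: "evaluates [input, wildcards k, of_word w, of_word (b # bs)]
      (Call 9 [Var 1, MkNode (Left (Var 3)) (Var 2)]) (pattern k (b # w)) (append_time S + S + 10)"
    apply (rule eval_le_weaken)
      apply (rule eval_le_Call_prog[OF append_pattern[OF len] prog_nth(10)])
       apply (simp; fail)
      apply (simp only: of_word_simps, (rule eval_le_rules | (simp; fail))+)
    using node by simp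
  have query: "evaluates [input, wildcards k, of_word w, of_word (b # bs)]
      (Query (Call 4 [Var 0, Call 9 [Var 1, MkNode (Left (Var 3)) (Var 2)]]))
      (of_boolean (\<not> refuted k (b # w))) (build_time S + append_time S + 2 * S + 30)"
    apply (rule eval_le_weaken)
      apply (rule eval_le_Query[where orc = "restricted_subset_query C L", OF _ query_answer])
       apply (rule eval_le_Call_prog[OF build_pattern[OF len] prog_nth(5)] app eval_le_rules
        | (simp; fail))+
    using dsize_query[OF len] by simp
  show ?case
  proof (cases "refuted k (b # w)")
    case True
    then obtain u where u: "counterexample u"
      "evaluates [input, wildcards k, of_word (b # w)] (complete_body letters) (no_answer u) t"
      using complete by blast
    have "evaluates [input, wildcards k, of_word w, of_word (b # bs)] try_body (no_answer u)
      (length (b # bs) * step_time S + t)"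
      unfolding try_body_def
      apply (rule eval_le_weaken)
        apply (rule eval_le_Cond_false[OF query])
         apply (simp add: of_boolean_def True; fail)
        apply (rule eval_le_Call_prog[OF u(2) prog_nth(3)])
         apply (simp; fail)
        apply (simp only: of_word_simps, (rule eval_le_rules | (simp; fail))+)
      using node by (simp add: step_time_def)
    with u(1) show ?thesis by blast
  next
    case False
    then obtain u where u: "counterexample u"
      "evaluates [input, wildcards k, of_word w, of_word bs] try_body (no_answer u)
        (length bs * step_time S + t)"
      using Cons by auto
    have "evaluates [input, wildcards k, of_word w, of_word (b # bs)] try_body (no_answer u)
      (length (b # bs) * step_time S + t)"
      apply (subst try_body_def)
      apply (rule eval_le_weaken)
        apply (rule eval_le_Cond_true[OF query])
         apply (simp add: of_boolean_def False; fail)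
        apply (rule eval_le_Call_prog[OF u(2) prog_nth(4)])
         apply (simp; fail)
        apply (simp only: of_word_simps, (rule eval_le_rules | (simp; fail))+)
      by (simp add: step_time_def)
    with u(1) show ?thesis by blast
  qed
qed simp

text \<open>\<open>refuted k w\<close> is the invariant. The last letter of a witnessing prefix is a
  successful candidate, and without wildcards the invariant says that \<open>w\<close> itself is a
  counterexample.\<close>

lemma complete_correct:
  "k + length w \<le> m \<Longrightarrow> refuted k w \<Longrightarrow> \<exists>u. counterexample u \<and>
    evaluates [input, wildcards k, of_word w] (complete_body letters) (no_answer u)
      (k * complete_time (length letters) S + S + 20)"
proof (induction k arbitrary: w)
  case 0
  have size: "dsize (of_word w) \<le> S" using 0 size_word by (simp add: dsize_of_word)
  have "evaluates [input, wildcards 0, of_word w] (complete_body letters) (no_answer w)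
      (0 * complete_time (length letters) S + S + 20)"
    unfolding complete_body_def no_answer_def of_boolean_def
    apply (rule eval_le_weaken[OF eval_le_Cond_false])
        apply (rule eval_le_rules | (simp; fail))+
    using size by simp
  moreover have "counterexample w" using 0 by (simp add: refuted_def)
  ultimately show ?case by blast
next
  case (Suc k)
  let ?t = "k * complete_time (length letters) S + S + 20"
  obtain v where v: "length v = Suc k" "counterexample (v @ w)"
    using Suc.prems(2) by (auto simp: refuted_def)
  then have "v = butlast v @ [last v]" by (metis append_butlast_last_id list.size(3)
    nat.distinct(1))
  then have "refuted k (last v # w)"
    using v unfolding refuted_def by (metis append.assoc append_Cons append_Nil diff_Suc_1
      length_butlast)
  then have ex: "\<exists>b\<in>set letters. refuted k (b # w)" by (auto simp: letters)
  have len: "k + length w < m" using Suc.prems by simp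
  have "\<exists>u. counterexample u \<and> evaluates [input, wildcards k, of_word (b # w)]
      (complete_body letters) (no_answer u) ?t" if "refuted k (b # w)" for b
    by (rule Suc.IH[OF _ that]) (use len in simp)
  from try_correct[OF this len ex] obtain u where u: "counterexample u"
    "evaluates [input, wildcards k, of_word w, of_word letters] try_body (no_answer u)
      (length letters * step_time S + ?t)"
    by blast
  have "evaluates [input, wildcards (Suc k), of_word w] (complete_body letters) (no_answer u)
      (Suc k * complete_time (length letters) S + S + 20)"
    apply (subst complete_body_def)
    apply (rule eval_le_weaken)
      apply (rule eval_le_Cond_true eval_le_Call_prog[OF u(2) prog_nth(4)]
        letters_correct[OF le_refl] eval_le_rules | (simp; fail))+
    by (simp add: complete_time_def)
  with u(1) show ?case by blast
qed

lemma length_query: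
  assumes "k \<le> m"
  shows "evaluates [input, wildcards k] (Query (Call 4 [Var 0, Var 1]))
    (of_boolean (\<not> refuted k [])) (build_time S + S + 10)"
proof -
  have len: "k + length ([] :: 'a list) \<le> m" using assms by simp
  have "pattern k [] = wildcards k" by (simp add: pattern_def wildcards_def)
  note build = build_pattern[OF len, unfolded this]
  show ?thesis
    apply (rule eval_le_weaken)
      apply (rule eval_le_Query[where orc = "restricted_subset_query C L", OF _ query_answer])
       apply (rule eval_le_Call_prog[OF build prog_nth(5)] eval_le_rules | (simp; fail))+
    using dsize_query[OF len] by simp
qed

lemma length_found:
  assumes "k \<le> m" "refuted k []"
  shows "\<exists>u. counterexample u \<and> evaluates [input, wildcards k] length_body (no_answer u)
    (step_time S + m * complete_time (length letters) S)"
proof -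
  obtain u where u: "counterexample u"
    "evaluates [input, wildcards k, of_word []] (complete_body letters) (no_answer u)
      (k * complete_time (length letters) S + S + 20)"
    using complete_correct[of k "[]"] assms by auto
  have "evaluates [input, wildcards k] length_body (no_answer u)
      (step_time S + m * complete_time (length letters) S)"
    unfolding length_body_def
    apply (rule eval_le_weaken)
      apply (rule eval_le_Cond_false[OF length_query[OF assms(1)]])
       apply (simp add: of_boolean_def assms(2); fail)
      apply (rule eval_le_Call_prog[OF u(2) prog_nth(3)])
       apply (simp; fail)
      apply (simp only: of_word_simps, (rule eval_le_rules | (simp; fail))+)
    using mult_le_mono1[OF assms(1), of "complete_time (length letters) S"]
    unfolding step_time_def of_word_simps dsize.simps by linarith
  with u(1) show ?thesis by blast
qed

text \<open>The induction is on the distance \<open>d\<close> to \<open>m\<close>, where success is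
  guaranteed; a shorter refuted length ends the loop earlier.\<close>

lemma length_correct:
  assumes "refuted m []"
  shows "k + d = m \<Longrightarrow> \<exists>u. counterexample u \<and> evaluates [input, wildcards k] length_body
    (no_answer u) (d * step_time S + (step_time S + m * complete_time (length letters) S))"
proof (induction d arbitrary: k)
  case 0
  then show ?case using length_found[of m] assms by simp
next
  case (Suc d)
  have k: "k \<le> m" using Suc.prems by simp
  show ?case
  proof (cases "refuted k []")
    case True
    then show ?thesis using length_found[OF k] eval_le_weaken[OF _ refl] by (meson le_add2)
  next
    case False
    obtain u where u: "counterexample u"
      "evaluates [input, wildcards (Suc k)] length_body (no_answer u)
        (d * step_time S + (step_time S + m * complete_time (length letters) S))"
      using Suc.IH[of "Suc k"] Suc.prems by auto
    have node: "dsize (wildcards k) \<le> S"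
      using k size_word dsize_of_number[of k, where 'a = 'a]
      by (simp add: wildcards_def of_number_def)
    have "evaluates [input, wildcards k] length_body (no_answer u)
        (Suc d * step_time S + (step_time S + m * complete_time (length letters) S))"
      apply (subst length_body_def)
      apply (rule eval_le_weaken)
        apply (rule eval_le_Cond_true[OF length_query[OF k]])
         apply (simp add: of_boolean_def False; fail)
        apply (rule eval_le_Call_prog[OF u(2) prog_nth(2)])
         apply (simp; fail)
        apply (simp only: wildcards_simps, (rule eval_le_rules | (simp; fail))+)
      using node by (simp add: step_time_def)
    with u(1) show ?thesis by blast
  qed
qed

section \<open>The two outcomes of the first query\<close>

lemma main_subset:
  assumes "lang (acceptor_of n is fs ts) \<subseteq> L"
  shows "evaluates [input] main_body yes_answer (total_time (length letters) S m)"
proof -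
  have query: "restricted_subset_query C L input True" using input_answer assms by simp
  show ?thesis
    unfolding main_body_def yes_answer_def of_boolean_def if_True
    apply (rule eval_le_weaken)
      apply (rule eval_le_Cond_true[OF eval_le_Query[where orc = "restricted_subset_query C L",
        OF _ query refl]])
        apply (rule eval_le_rules | (simp add: of_boolean_def; fail))+
    using size_input by (simp add: total_time_def)
qed

lemma main_not_subset:
  assumes "counterexample u" "length u = m"
  shows "\<exists>u. counterexample u \<and>
    evaluates [input] main_body (no_answer u) (total_time (length letters) S m)"
proof -
  have "\<not> lang (acceptor_of n is fs ts) \<subseteq> L"
    using assms(1) unfolding counterexample_def by blast
  with input_answer have query: "restricted_subset_query C L input False" by simp
  have "refuted m []" using assms by (auto simp: refuted_def)
  then obtain u where u: "counterexample u" "evaluates [input,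
    wildcards 0] length_body (no_answer u)
      (m * step_time S + (step_time S + m * complete_time (length letters) S))"
    using length_correct[of 0 m] by auto
  have "evaluates [input] main_body (no_answer u) (total_time (length letters) S m)"
    unfolding main_body_def
    apply (rule eval_le_weaken)
      apply (rule eval_le_Cond_false[OF eval_le_Query[where orc = "restricted_subset_query C L",
        OF _ query refl]])
        apply (rule eval_le_Var; simp)
       apply (simp add: of_boolean_def; fail)
      apply (rule eval_le_Call_prog[OF u(2) prog_nth(2)])
       apply (simp; fail)
      apply (simp only: wildcards_simps, (rule eval_le_rules | (simp; fail))+)
    using size_input by (simp add: total_time_def)
  with u(1) show ?thesis by blast
qed

end

section \<open>Polynomial bounds\<close>

text \<open>With base \<open>x + 1\<close>, which is at least 1, powers grow with the exponent, so
  sums are bounded by adding the exponents.\<close>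

definition poly_bounded :: "(nat \<Rightarrow> nat) \<Rightarrow> bool" where
  "poly_bounded f \<longleftrightarrow> (\<exists>c d. \<forall>x. f x \<le> c * (x + 1) ^ d)"

lemma poly_bounded_const: "poly_bounded (\<lambda>x. k)"
  unfolding poly_bounded_def by (intro exI[of _ k] exI[of _ 0]) simp

lemma poly_bounded_id: "poly_bounded (\<lambda>x. x)"
  unfolding poly_bounded_def by (intro exI[of _ 1]) simp

lemma poly_bounded_add:
  assumes "poly_bounded f" "poly_bounded g"
  shows "poly_bounded (\<lambda>x. f x + g x)"
proof -
  obtain c d c' d' where f: "\<And>x. f x \<le> c * (x + 1) ^ d" and g: "\<And>x. g x \<le> c' * (x + 1) ^ d'"
    using assms unfolding poly_bounded_def by blast
  have "f x + g x \<le> (c + c') * (x + 1) ^ (d + d')" for x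
  proof -
    have "f x \<le> c * (x + 1) ^ (d + d')"
      by (rule order_trans[OF f mult_le_mono2[OF power_increasing]]) auto
    moreover have "g x \<le> c' * (x + 1) ^ (d + d')"
      by (rule order_trans[OF g mult_le_mono2[OF power_increasing]]) auto
    ultimately show ?thesis unfolding add_mult_distrib by (rule add_mono)
  qed
  then show ?thesis unfolding poly_bounded_def by blast
qed

lemma poly_bounded_mult:
  assumes "poly_bounded f" "poly_bounded g"
  shows "poly_bounded (\<lambda>x. f x * g x)"
proof -
  obtain c d c' d' where f: "\<And>x. f x \<le> c * (x + 1) ^ d" and g: "\<And>x. g x \<le> c' * (x + 1) ^ d'"
    using assms unfolding poly_bounded_def by blast
  have "f x * g x \<le> (c * c') * (x + 1) ^ (d + d')" for x
    using mult_le_mono[OF f[of x] g[of x]] by (simp only: power_add ac_simps)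
  then show ?thesis unfolding poly_bounded_def by blast
qed

lemmas poly_bounded_intros = poly_bounded_const poly_bounded_id poly_bounded_add poly_bounded_mult

lemma poly_bounded_size_bound: "poly_bounded (size_bound s)"
  unfolding size_bound_def by (intro poly_bounded_intros)

lemma poly_bounded_times:
  assumes "poly_bounded f"
  shows "poly_bounded (\<lambda>x. append_time (f x))" "poly_bounded (\<lambda>x. offset_time (f x))"
    "poly_bounded (\<lambda>x. shift_time (f x))" "poly_bounded (\<lambda>x. layer_time (f x))"
    "poly_bounded (\<lambda>x. transitions_time (f x))" "poly_bounded (\<lambda>x. build_time (f x))"
    "poly_bounded (\<lambda>x. step_time (f x))" "poly_bounded (\<lambda>x. complete_time c (f x))"
  unfolding append_time_def offset_time_def shift_time_def layer_time_def transitions_time_def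
    build_time_def step_time_def complete_time_def
  by (intro poly_bounded_intros assms)+

text \<open>A single variable stands for both the number of states of the largest product and
  \<open>m\<close>; the summand \<open>2 * x + 1\<close> makes room for the words and wildcard
  lists.\<close>

definition total_bound :: "nat \<Rightarrow> nat \<Rightarrow> nat" where
  "total_bound s x = total_time s (size_bound s x + 2 * x + 1) x"

lemma poly_bounded_total_bound: "poly_bounded (total_bound s)"
  unfolding total_bound_def total_time_def
  by (intro poly_bounded_intros poly_bounded_times poly_bounded_size_bound)

lemma size_bound_mono: "x \<le> y \<Longrightarrow> size_bound s x \<le> size_bound s y"
  unfolding size_bound_def by (intro add_mono mult_le_mono le_refl)

lemma total_time_mono: "m \<le> m' \<Longrightarrow> total_time c S m \<le> total_time c S m'"
  unfolding total_time_def by (intro add_mono mult_le_mono le_refl)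

text \<open>Expanding both factors by the binomial theorem gives the coefficients.\<close>

lemma bivariate_polynomial_power: "bivariate_polynomial (\<lambda>x y. c * ((x + 1) * (y + 1)) ^ d)"
proof -
  have "c * ((x + 1) * (y + 1)) ^ d =
      (\<Sum>i\<le>d. \<Sum>j\<le>d. (c * (d choose i) * (d choose j)) * x ^ i * y ^ j)" for x y :: nat
  proof -
    have eq: "(z + 1) ^ d = (\<Sum>i\<le>d. (d choose i) * z ^ i)" for z :: nat
      using binomial[of z 1 d] by simp
    show ?thesis
      unfolding power_mult_distrib eq sum_product
      unfolding sum_distrib_left by (simp only: ac_simps)
  qed
  then show ?thesis unfolding bivariate_polynomial_def
    by (intro exI[of _ d] exI[of _ "\<lambda>i j. c * (d choose i) * (d choose j)"] allI)
qed

text \<open>The summand \<open>card (states M) * (m + 2)\<close> counts the states of the product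
  for a pattern of length \<open>m\<close>. No acceptor for \<open>L\<close> occurs, so this also
  covers languages that are not regular.\<close>

lemma search_run:
  fixes M :: "(nat, 'a :: finite) acceptor"
  assumes "C \<in> {nfa, dfa}" "C M" "describes d M" "set letters = UNIV" "distinct letters"
    and m: "if lang M \<subseteq> L then m = 0 else \<exists>u\<in>lang M - L. length u = m"
  shows "\<exists>v t. runs (prog letters) (restricted_subset_query C L) d v t
    \<and> correct_unrestricted_answer M L v
    \<and> t \<le> total_bound (card (UNIV :: 'a set)) (card (states M) * (m + 2) + m)"
proof -
  let ?n = "card (states M)" and ?s = "card (UNIV :: 'a set)"
  let ?x = "?n * (m + 2) + m"
  let ?S = "size_bound ?s ?x + 2 * ?x + 1"
  obtain "is" fs ts where d: "d = encode ?n is fs ts" and A: "C (acceptor_of ?n is fs ts)"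
    and dist: "distinct is" "distinct fs" "distinct ts"
    and lang: "lang (acceptor_of ?n is fs ts) = lang M"
    using describes_obtain[OF assms(1-3)] by metis
  have nfa: "nfa (acceptor_of ?n is fs ts)" using A assms(1) by (auto simp: dfa_def)
  interpret search C L letters ?n "is" fs ts m ?S
  proof
    show "dsize (encode ?n is fs ts) \<le> ?S"
      using dsize_encode_le[OF nfa dist] size_bound_mono[of ?n ?x ?s] by simp
    show "dsize (build ?n is fs ts pat) \<le> ?S" if "length pat \<le> m" for pat
    proof -
      have "dsize (build ?n is fs ts pat) \<le> size_bound ?s (?n * (length pat + 2))"
        unfolding build_def
        using nfa_restrict[OF nfa] dist distinct_transitions nfa
        by (intro dsize_encode_le) (auto simp: restrict_def distinct_map nfa_acceptor_of)
      also have "\<dots> \<le> size_bound ?s ?x"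
        using that by (intro size_bound_mono trans_le_add1[OF mult_le_mono2]) simp
      finally show ?thesis by simp
    qed
  qed (use assms A dist in auto)
  have le: "total_time (length letters) ?S m \<le> total_bound ?s ?x"
    using assms(4,5) total_time_mono[of m ?x] by (metis distinct_card total_bound_def le_add2)
  have "\<exists>v. correct_unrestricted_answer M L v \<and>
      evaluates [d] main_body v (total_time (length letters) ?S m)"
  proof (cases "lang M \<subseteq> L")
    case True
    then have "correct_unrestricted_answer M L yes_answer"
      by (simp add: correct_unrestricted_answer_def)
    moreover have "evaluates [d] main_body yes_answer (total_time (length letters) ?S m)"
      unfolding d by (rule main_subset) (simp only: lang True)
    ultimately show ?thesis by blast
  next
    case False
    then obtain u where "counterexample u" "length u = m"
      using m unfolding counterexample_def lang by auto
    from main_not_subset[OF this] obtain u where "counterexample u"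
      "evaluates [d] main_body (no_answer u) (total_time (length letters) ?S m)" unfolding d
        by blast
    moreover from this(1) False have "correct_unrestricted_answer M L (no_answer u)"
      unfolding counterexample_def lang correct_unrestricted_answer_def if_not_P[OF False] by blast
    ultimately show ?thesis by blast
  qed
  then obtain v t where "correct_unrestricted_answer M L v"
    "t \<le> total_time (length letters) ?S m"
    "eval (prog letters) (restricted_subset_query C L) [d] (prog letters ! 0) v t"
    unfolding eval_le_def prog_nth by blast
  moreover have "prog letters \<noteq> []" by (simp add: prog_def)
  ultimately show ?thesis using le_trans[OF _ le] unfolding runs_def by blast
qed

theorem theorem6p1:
  "\<exists>(R :: ('a::finite) program) p. bivariate_polynomial p \<and>
     (\<forall>C \<in> {nfa, dfa}. \<forall>(L :: 'a list set) (M :: (nat, 'a) acceptor) d.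
        C M \<longrightarrow> describes d M \<longrightarrow>
        (\<exists>v t. runs R (restricted_subset_query C L) d v t
           \<and> correct_unrestricted_answer M L v
           \<and> (\<forall>T :: (nat, 'a) acceptor. dfa T \<longrightarrow> lang T = L \<longrightarrow>
                t \<le> p (card (states M)) (card (states T)))))"
proof -
  obtain letters :: "'a list" where letters: "set letters = UNIV" "distinct letters"
    using finite_distinct_list[of "UNIV :: 'a set"] by auto
  let ?s = "card (UNIV :: 'a set)"
  obtain c e where bound: "\<And>x. total_bound ?s x \<le> c * (x + 1) ^ e"
    using poly_bounded_total_bound unfolding poly_bounded_def by blast
  \<comment> \<open>The argument of \<open>total_bound\<close>, plus 1, will be at most twice the
    square of \<open>(x + 1) * (y + 1)\<close>; its power \<open>e\<close> gives the factor
    \<open>2 ^ e\<close> and the exponent \<open>2 * e\<close>.\<close>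
  let ?p = "\<lambda>x y. c * 2 ^ e * ((x + 1) * (y + 1)) ^ (2 * e) :: nat"
  have run: "\<exists>v t. runs (prog letters) (restricted_subset_query C L) d v t
      \<and> correct_unrestricted_answer M L v
      \<and> (\<forall>T :: (nat, 'a) acceptor. dfa T \<longrightarrow> lang T = L \<longrightarrow> t \<le> ?p (card (states M)) (card (states T)))"
    if C: "C \<in> {nfa, dfa}" "C M" and d: "describes d M"
    for C L d and M :: "(nat, 'a) acceptor"
  proof -
    let ?n = "card (states M)"
    have nfa: "nfa M" using C by (auto simp: dfa_def)
    \<comment> \<open>The length is fixed before any \<open>T\<close> is considered, so one run
      serves all of them.\<close>
    have "\<exists>m. (if lang M \<subseteq> L then m = 0 else \<exists>u\<in>lang M - L. length u = m) \<and>
        (\<forall>u\<in>lang M - L. m \<le> length u)"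
    proof (cases "lang M \<subseteq> L")
      case False
      then obtain u where "u \<in> lang M - L" by blast
      then obtain u where "u \<in> lang M - L" "\<And>u'. u' \<in> lang M - L \<Longrightarrow> length u \<le> length u'"
        using ex_has_least_nat[of "\<lambda>u. u \<in> lang M - L" u length] by blast
      with False show ?thesis by auto
    qed auto
    then obtain m where m: "if lang M \<subseteq> L then m = 0 else \<exists>u\<in>lang M - L. length u = m"
      and least: "\<And>u. u \<in> lang M - L \<Longrightarrow> m \<le> length u" by blast
    obtain v t where v: "runs (prog letters) (restricted_subset_query C L) d v t"
      "correct_unrestricted_answer M L v" and t: "t \<le> total_bound ?s (?n * (m + 2) + m)"
      using search_run[OF C d letters m] by blast
    have "t \<le> ?p ?n (card (states T))" if T: "dfa T" "lang T = L" for T :: "(nat, 'a) acceptor"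
    proof -
      let ?k = "card (states T)"
      \<comment> \<open>Only here does the regularity of \<open>L\<close> enter; without a
        counterexample \<open>m\<close> is 0.\<close>
      have "m \<le> ?n * ?k"
      proof (cases "lang M \<subseteq> L")
        case False
        then obtain u where "u \<in> lang M - lang T" using T by blast
        from short_counterexample[OF nfa T(1) this] show ?thesis using least T(2) by fastforce
      qed (use m in simp)
      then have "?n * (m + 2) + m + 1 \<le> ?n * (?n * ?k + 2) + ?n * ?k + 1"
        by (intro add_mono mult_le_mono le_refl)
      also have "\<dots> \<le> 2 * ((?n + 1) * (?k + 1)) ^ 2"
        by (simp add: power2_eq_square algebra_simps)
      finally have "(?n * (m + 2) + m + 1) ^ e \<le> (2 * ((?n + 1) * (?k + 1)) ^ 2) ^ e"
        by (rule power_mono) simp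
      then have "c * (?n * (m + 2) + m + 1) ^ e \<le> ?p ?n ?k"
        by (simp only: power_mult_distrib power_mult mult.assoc mult_le_mono2)
      with t bound[of "?n * (m + 2) + m"] show ?thesis by linarith
    qed
    with v show ?thesis by blast
  qed
  show ?thesis
    using bivariate_polynomial_power[of "c * 2 ^ e" "2 * e"] run
    by (intro exI[of _ "prog letters"] exI[of _ ?p]) blast
qed

end
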